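(* Let $q$ be an odd prime power and $n\ge0$ an integer. Fix characters $\omega\colon\mathbb F_q^\times\to\mathbb C^\times$ and $\psi\colon\mathbb F_q\to\mathbb C^\times$ and some $T\in\operatorname{Alt}_{2n}^\times$, and set $$g_{2n}(\omega,\psi,T)=\sum_{A\in\operatorname{Alt}_{2n}^\times}\omega(\det A)\psi(\operatorname{tr}AT).$$ (a) Suppose $\psi\ne1$. Then $$g_{2n}(\omega,\psi,T)=\frac{q^{n(n-1)}}{\omega(\det T)}\cdot g(\omega^2,\psi^2)^n.$$ (b) Suppose $\psi=1$ and $\omega^2=1$. Then $$g_{2n}(\omega,1,T)=q^{n(n-1)}\prod_{i=1}^{n}\left(q^{2i-1}-1\right).$$ (c) If $\psi=1$ and $\omega^2\ne1$, the sum $g_{2n}(\omega,\psi,T)$ vanishes when $n$ is positive.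
   Context: $\operatorname{Alt}_{2n}^\times$ is the set of invertible alternating ($A^\intercal=-A$) $2n\times2n$ matrices over $\mathbb F_q$. $g(\omega,\psi)=\sum_{a\in\mathbb F_q^\times}\omega(a)\psi(a)$ is the usual Gauss sum, and $\omega^2,\psi^2$ denote the pointwise squares of the characters, so $\psi^2(a)=\psi(2a)$. *)

theory Defs
  imports Complex_Main "HOL-Library.Cardinality" "Jordan_Normal_Form.Determinant"
begin

(* A character of the multiplicative group is a function on the whole field of which
   only the values at nonzero elements matter; the value at 0 is never used. *)
definition mult_character :: "('a::field \<Rightarrow> complex) \<Rightarrow> bool" where
  "mult_character \<omega> \<longleftrightarrow>
     (\<forall>a. a \<noteq> 0 \<longrightarrow> \<omega> a \<noteq> 0) \<and>
     (\<forall>a b. a \<noteq> 0 \<longrightarrow> b \<noteq> 0 \<longrightarrow> \<omega> (a * b) = \<omega> a * \<omega> b)"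

definition add_character :: "('a::field \<Rightarrow> complex) \<Rightarrow> bool" where
  "add_character \<psi> \<longleftrightarrow>
     (\<forall>a. \<psi> a \<noteq> 0) \<and> (\<forall>a b. \<psi> (a + b) = \<psi> a * \<psi> b)"

definition gauss_sum :: "('a::{field,finite} \<Rightarrow> complex) \<Rightarrow> ('a \<Rightarrow> complex) \<Rightarrow> complex" where
  "gauss_sum \<omega> \<psi> = (\<Sum>a\<in>{a. a \<noteq> 0}. \<omega> a * \<psi> a)"

definition mat_trace :: "'a::comm_monoid_add mat \<Rightarrow> 'a" where
  "mat_trace A = (\<Sum>i<dim_row A. A $$ (i, i))"

(* In characteristic 2 one would also have to require a zero diagonal;
   here the field always has odd order. *)
definition inv_alt_mats :: "nat \<Rightarrow> 'a::field mat set" where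
  "inv_alt_mats m = {A \<in> carrier_mat m m. transpose_mat A = - A \<and> invertible_mat A}"

definition alt_gauss_sum ::
  "nat \<Rightarrow> ('a::{field,finite} \<Rightarrow> complex) \<Rightarrow> ('a \<Rightarrow> complex) \<Rightarrow> 'a mat \<Rightarrow> complex" where
  "alt_gauss_sum m \<omega> \<psi> T = (\<Sum>A\<in>inv_alt_mats m. \<omega> (det A) * \<psi> (mat_trace (A * T)))"

end

theory Submission
  imports Defs
begin

text \<open>
  The proof is an induction on $n$ that splits off one hyperbolic plane at a time.  Write an
  alternating matrix of size $m + 2$ in blocks with an upper left block of size two, determined by
  the pivot $a = A_{01}$.

  If $a \ne 0$, block Gauss elimination gives unique coordinates $(a, c, d, B)$, where $c$ and $d$
  are vectors of length $m$ and $B$ is an invertible alternating matrix of size $m$, with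
  $\det A = a^2 \det B$ (\<open>sum_sheared_sum\<close>).  A Gauss sum depends on $T$ only up to congruence by
  matrices of determinant $1$, so $T$ may be taken to be the orthogonal sum of a hyperbolic plane
  with parameter $t \ne 0$ and an invertible alternating matrix $T'$ of size $m$
  (\<open>exists_congruent_hyp_sum\<close>).  Then
  \[ \mathrm{tr}(A T) = -2 a t + \mathrm{tr}(B T') - 2 a\, (c \cdot T' d), \]
  so the matrices with $a \ne 0$ contribute the product of $g(\omega^2, \psi^2) / \omega(t^2)$, of
  the sum of $\psi(-2 a\, (c \cdot T' d))$ over all $c$ and $d$, which is $q^m$ by orthogonality of
  characters, and of the Gauss sum for $T'$.

  The matrices with $a = 0$ contribute nothing when $\psi$ is nontrivial: adding multiples of row
  and column $0$ to the later rows and columns fixes the determinant and the pivot but twists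
  $\psi(\mathrm{tr}(A T))$ by a nontrivial character of the multipliers, because the first row of
  $A$ is nonzero (\<open>sum_off_pivot_eq_0\<close>).  This yields the recursion
  \<open>alt_gauss_sum_hyp_sum\<close> and with it the formula for nontrivial $\psi$.

  When $\psi = 1$ and $\omega^2 = 1$, the sum is organised by the first row of $A$.  A row with
  $a \ne 0$ fixes $a$ and $d$ and leaves $c$ and $B$ free, and a congruence of determinant $1$ carries
  any nonzero row to such a row.  Hence each of the $q^{m+1} - 1$ nonzero rows contributes $q^m$
  times the sum for size $m$ (\<open>sum_character_det_recursion\<close>).  When $\psi = 1$ and
  $\omega^2 \ne 1$, scaling one row and column multiplies the sum by a value
  $\omega(a)^2 \ne 1$, so it vanishes.
\<close>

section \<open>Sums over vectors, traces and congruence\<close>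

text \<open>
  Translating the summation variable of $\sum_x x$ by $1$ shows that the number of field elements
  vanishes in the field; an odd number would then be $1$ if $2$ were $0$.
\<close>

lemma two_neq_zero_of_odd_card:
  assumes "odd CARD('a::{field,finite})"
  shows "(2::'a) \<noteq> 0"
proof
  assume two: "(2::'a) = 0"
  have "bij (\<lambda>x::'a. x + 1)"
    by (rule bij_betw_byWitness[where f' = "\<lambda>x. x - 1"]) auto
  then have "(\<Sum>x\<in>UNIV. x + 1) = (\<Sum>x\<in>(UNIV::'a set). x)"
    by (rule sum.reindex_bij_betw)
  then have "(of_nat CARD('a) :: 'a) = 0"
    by (simp add: sum.distrib)
  moreover obtain k where "CARD('a) = 2 * k + 1"
    using assms by (rule oddE)
  ultimately show False
    using two by simp
qed

lemma bij_betw_vec_PiE: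
  "bij_betw (vec m) ({..<m} \<rightarrow>\<^sub>E (UNIV::'a set)) (carrier_vec m)"
proof (rule bij_betwI)
  show "vec m \<in> ({..<m} \<rightarrow>\<^sub>E UNIV) \<rightarrow> (carrier_vec m :: 'a vec set)"
    by simp
  show "(\<lambda>v. restrict (($) v) {..<m}) \<in> (carrier_vec m :: 'a vec set) \<rightarrow> ({..<m} \<rightarrow>\<^sub>E UNIV)"
    by simp
  show "restrict (($) (vec m f)) {..<m} = f" if "f \<in> {..<m} \<rightarrow>\<^sub>E UNIV" for f :: "nat \<Rightarrow> 'a"
    using that by (intro PiE_ext[OF _ that]) simp_all
  show "vec m (restrict (($) v) {..<m}) = v" if "v \<in> carrier_vec m" for v :: "'a vec"
    using that by (intro eq_vecI) simp_all
qed

lemma finite_carrier_vec: "finite (carrier_vec m :: 'a::finite vec set)"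
proof -
  have "finite ({..<m} \<rightarrow>\<^sub>E (UNIV::'a set))"
    by (rule finite_PiE) simp_all
  then show ?thesis
    using bij_betw_finite[OF bij_betw_vec_PiE[of m, where 'a='a]] by (rule iffD1[rotated])
qed

lemma card_carrier_vec: "card (carrier_vec m :: 'a::finite vec set) = CARD('a) ^ m"
proof -
  have "card (carrier_vec m :: 'a vec set) = card ({..<m} \<rightarrow>\<^sub>E (UNIV::'a set))"
    by (rule bij_betw_same_card[OF bij_betw_vec_PiE, symmetric])
  then show ?thesis
    by (simp add: card_PiE)
qed

lemma finite_carrier_mat: "finite (carrier_mat m n :: 'a::finite mat set)"
proof -
  let ?F = "({..<m} \<times> {..<n}) \<rightarrow>\<^sub>E (UNIV::'a set)"
  have fin: "finite ?F"
    by (rule finite_PiE) simp_all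
  have "A \<in> mat m n ` ?F" if A: "A \<in> carrier_mat m n" for A
  proof (rule image_eqI)
    show "A = mat m n (restrict (($$) A) ({..<m} \<times> {..<n}))"
      using A by (intro eq_matI) simp_all
    show "restrict (($$) A) ({..<m} \<times> {..<n}) \<in> ?F"
      unfolding restrict_PiE_iff by simp
  qed
  then have "carrier_mat m n \<subseteq> mat m n ` ?F"
    by (rule subsetI)
  with fin show ?thesis
    by (rule finite_surj)
qed

text \<open>
  Orthogonality: for $v \ne 0$ the map $u \mapsto \psi(u \cdot v)$ is a nontrivial character of the
  vector group, so translating $u$ by a vector $e$ with $\psi(e \cdot v) \ne 1$ multiplies the sum
  by a factor other than $1$.
\<close>

lemma sum_add_character_scalar_prod:
  fixes \<psi> :: "'a::{field,finite} \<Rightarrow> complex"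
  assumes \<psi>: "add_character \<psi>" "\<psi> \<noteq> (\<lambda>_. 1)" and v: "v \<in> carrier_vec m"
  shows "(\<Sum>u\<in>carrier_vec m. \<psi> (u \<bullet> v)) = (if v = 0\<^sub>v m then of_nat CARD('a) ^ m else 0)"
proof (cases "v = 0\<^sub>v m")
  case True
  have "\<psi> (0 + 0) = \<psi> 0 * \<psi> 0" "\<psi> 0 \<noteq> 0" using \<psi>(1) unfolding add_character_def by blast+
  then have "\<psi> 0 = 1" by simp
  then show ?thesis using True by (simp add: card_carrier_vec)
next
  case False
  then obtain k where k: "k < m" "v $ k \<noteq> 0" using v by (metis carrier_vecD eq_vecI index_zero_vec)
  obtain b where b: "\<psi> b \<noteq> 1" using \<psi>(2) by auto
  define e where "e = (b / v $ k) \<cdot>\<^sub>v unit_vec m k"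
  have e: "e \<in> carrier_vec m" "e \<bullet> v = b"
    using k v by (auto simp: e_def)
  have "bij_betw (\<lambda>u. u + e) (carrier_vec m) (carrier_vec m)"
    by (rule bij_betw_byWitness[where f' = "\<lambda>u. u - e"]) (use e in auto)
  then have "(\<Sum>u\<in>carrier_vec m. \<psi> (u \<bullet> v)) = (\<Sum>u\<in>carrier_vec m. \<psi> ((u + e) \<bullet> v))"
    by (rule sum.reindex_bij_betw[symmetric])
  also have "\<dots> = \<psi> b * (\<Sum>u\<in>carrier_vec m. \<psi> (u \<bullet> v))"
    unfolding sum_distrib_left
    by (rule sum.cong)
       (use \<psi>(1) v e in \<open>simp_all add: add_scalar_prod_distrib[of _ m] add_character_def mult.commute\<close>)
  finally show ?thesis using b False by auto
qed

lemma invertible_mat_iff_det: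
  fixes A :: "'a::field mat"
  assumes A: "A \<in> carrier_mat m m"
  shows "invertible_mat A \<longleftrightarrow> det A \<noteq> 0"
proof
  assume "invertible_mat A"
  then obtain B where B: "A * B = 1\<^sub>m m" "B * A = 1\<^sub>m (dim_row B)"
    using A unfolding invertible_mat_def inverts_mat_def by auto
  from B(1) have "dim_col B = m" by (metis index_mult_mat(3) index_one_mat(3))
  moreover from B(2) A have "dim_row B = m" by (metis carrier_matD(2) index_mult_mat(3) index_one_mat(3))
  ultimately have "B \<in> carrier_mat m m" by auto
  then have "det A * det B = 1" using A B(1) by (metis det_mult det_one)
  then show "det A \<noteq> 0" by auto
next
  assume "det A \<noteq> 0"
  from det_non_zero_imp_unit[OF A this] obtain B where "B \<in> carrier_mat m m" "B * A = 1\<^sub>m m" "A * B = 1\<^sub>m m"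
    unfolding Units_def ring_mat_def by auto
  then show "invertible_mat A"
    using A unfolding invertible_mat_def inverts_mat_def by auto
qed

lemma mem_inv_alt_mats_iff:
  "A \<in> inv_alt_mats m \<longleftrightarrow>
     A \<in> carrier_mat m m \<and> (\<forall>i<m. \<forall>j<m. A $$ (j, i) = - A $$ (i, j)) \<and> det A \<noteq> 0"
proof -
  have "transpose_mat A = - A \<longleftrightarrow> (\<forall>i<m. \<forall>j<m. A $$ (j, i) = - A $$ (i, j))" if "A \<in> carrier_mat m m"
    using that by (auto simp: mat_eq_iff)
  then show ?thesis
    unfolding inv_alt_mats_def using invertible_mat_iff_det by blast
qed

lemma inv_alt_matsD:
  assumes "A \<in> inv_alt_mats m"
  shows "A \<in> carrier_mat m m" and "det A \<noteq> 0"
    and "i < m \<Longrightarrow> j < m \<Longrightarrow> A $$ (j, i) = - A $$ (i, j)"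
  using assms unfolding mem_inv_alt_mats_iff by blast+

lemma inv_alt_mats_diag:
  fixes A :: "'a::field mat"
  assumes "(2::'a) \<noteq> 0" and "A \<in> inv_alt_mats m" and "i < m"
  shows "A $$ (i, i) = 0"
proof -
  have "2 * A $$ (i, i) = 0"
    using inv_alt_matsD(3)[OF assms(2,3,3)] by (simp add: eq_neg_iff_add_eq_0)
  then show ?thesis using assms(1) by simp
qed

lemma finite_inv_alt_mats: "finite (inv_alt_mats m :: 'a::{field,finite} mat set)"
  by (rule finite_subset[OF _ finite_carrier_mat]) (auto simp: inv_alt_mats_def)

lemma mat_trace_mult:
  assumes "A \<in> carrier_mat m k" "B \<in> carrier_mat k m"
  shows "mat_trace (A * B) = (\<Sum>i<m. \<Sum>j<k. A $$ (i, j) * B $$ (j, i))"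
  using assms by (simp add: mat_trace_def scalar_prod_def atLeast0LessThan)

lemma mat_trace_mult_commute:
  fixes A :: "'a::comm_semiring_0 mat"
  assumes "A \<in> carrier_mat m k" "B \<in> carrier_mat k m"
  shows "mat_trace (A * B) = mat_trace (B * A)"
proof -
  have "(\<Sum>i<m. \<Sum>j<k. A $$ (i, j) * B $$ (j, i)) = (\<Sum>j<k. \<Sum>i<m. B $$ (j, i) * A $$ (i, j))"
    by (subst sum.swap) (simp only: mult.commute)
  then show ?thesis
    by (simp only: mat_trace_mult[OF assms] mat_trace_mult[OF assms(2,1)])
qed

lemma congruence_inv_alt_mats:
  fixes A :: "'a::field mat"
  assumes A: "A \<in> inv_alt_mats m" and P: "P \<in> carrier_mat m m" "det P \<noteq> 0"
  shows "P * A * transpose_mat P \<in> inv_alt_mats m"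
    and "det (P * A * transpose_mat P) = det P ^ 2 * det A"
proof -
  have Ac: "A \<in> carrier_mat m m" and At: "transpose_mat A = - A" and dA: "det A \<noteq> 0"
    using A by (auto simp: inv_alt_mats_def invertible_mat_iff_det)
  show det: "det (P * A * transpose_mat P) = det P ^ 2 * det A"
    using Ac P by (simp add: det_mult[of _ m] det_transpose[of _ m] power2_eq_square)
  have "transpose_mat (P * A * transpose_mat P) = P * transpose_mat A * transpose_mat P"
    using Ac P by (simp add: transpose_mult[of _ m m _ m] assoc_mult_mat[of _ m m _ m _ m])
  also have "\<dots> = - (P * A * transpose_mat P)"
    unfolding At using Ac P by simp
  finally have "transpose_mat (P * A * transpose_mat P) = - (P * A * transpose_mat P)" .
  moreover have carr: "P * A * transpose_mat P \<in> carrier_mat m m"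
    using Ac P(1) by simp
  moreover have "invertible_mat (P * A * transpose_mat P)"
    unfolding invertible_mat_iff_det[OF carr] det using dA P(2) by simp
  ultimately show "P * A * transpose_mat P \<in> inv_alt_mats m"
    unfolding inv_alt_mats_def by blast
qed

text \<open>
  The source of every symmetry below: each sum over invertible alternating matrices is invariant
  under replacing $A$ by $P A P^T$.
\<close>

lemma bij_betw_congruence:
  fixes P :: "'a::{field,finite} mat"
  assumes P: "P \<in> carrier_mat m m" "det P \<noteq> 0"
  shows "bij_betw (\<lambda>A. P * A * transpose_mat P) (inv_alt_mats m) (inv_alt_mats m)"
proof -
  obtain Q where Q: "Q \<in> carrier_mat m m" "Q * P = 1\<^sub>m m" "P * Q = 1\<^sub>m m"
    using det_non_zero_imp_unit[OF P] unfolding Units_def ring_mat_def by auto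
  have PQt: "transpose_mat P * transpose_mat Q = 1\<^sub>m m"
    by (simp_all only: transpose_mult[OF Q(1) P(1), symmetric] transpose_mult[OF P(1) Q(1), symmetric] Q(2,3) transpose_one)
  have cancel: "Q * (P * A * transpose_mat P) * transpose_mat Q = A"
    if A: "A \<in> carrier_mat m m" for A
  proof -
    have "Q * (P * A * transpose_mat P) * transpose_mat Q
        = (Q * P) * A * (transpose_mat P * transpose_mat Q)"
      using A P(1) Q(1) by (simp add: assoc_mult_mat[of _ m m _ m _ m])
    also have "\<dots> = A"
      unfolding Q(2) PQt using A by simp
    finally show ?thesis .
  qed
  have inj: "inj_on (\<lambda>A. P * A * transpose_mat P) (inv_alt_mats m)"
    by (rule inj_on_inverseI[where g = "\<lambda>B. Q * B * transpose_mat Q"], rule cancel)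
       (simp add: inv_alt_mats_def)
  have "(\<lambda>A. P * A * transpose_mat P) ` inv_alt_mats m \<subseteq> inv_alt_mats m"
    using congruence_inv_alt_mats(1)[OF _ P] by (rule image_subsetI)
  from endo_inj_surj[OF finite_inv_alt_mats this inj] show ?thesis
    using inj unfolding bij_betw_def by (rule conjI[rotated])
qed

section \<open>Splitting off a hyperbolic plane\<close>

text \<open>
  The alternating form of a hyperbolic plane whose basis vectors pair to $a$.
\<close>

definition hyp_mat :: "'a::field \<Rightarrow> 'a mat" where
  "hyp_mat a = mat 2 2 (\<lambda>(i, j). if i = j then 0 else if i = 0 then a else - a)"

definition two_cols :: "nat \<Rightarrow> 'a vec \<Rightarrow> 'a vec \<Rightarrow> 'a mat" where
  "two_cols m c d = mat m 2 (\<lambda>(i, j). if j = 0 then c $ i else d $ i)"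

text \<open>
  The alternating matrix $c d^T - d c^T$ of rank at most two.
\<close>

definition wedge :: "nat \<Rightarrow> 'a::field vec \<Rightarrow> 'a vec \<Rightarrow> 'a mat" where
  "wedge m c d = mat m m (\<lambda>(i, j). c $ i * d $ j - d $ i * c $ j)"

definition hyp_sum :: "nat \<Rightarrow> 'a::field \<Rightarrow> 'a mat \<Rightarrow> 'a mat" where
  "hyp_sum m a B = four_block_mat (hyp_mat a) (0\<^sub>m 2 m) (0\<^sub>m m 2) B"

text \<open>
  The unipotent matrix that adds $c_i$ times row $0$ and $d_i$ times row $1$ to row $i + 2$.
\<close>

definition shear :: "nat \<Rightarrow> 'a::field vec \<Rightarrow> 'a vec \<Rightarrow> 'a mat" where
  "shear m c d = four_block_mat (1\<^sub>m 2) (0\<^sub>m 2 m) (two_cols m c d) (1\<^sub>m m)"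

text \<open>
  Coordinates $(a, c, d, B)$ for an alternating matrix $A$ whose entry $a = A_{01}$ is nonzero: a
  block Gauss elimination clears the first two rows and columns of $A$, and $B$ is the Schur
  complement that remains.  It is parametrised by the elimination multipliers $c$, $d$ rather than
  by the first two rows because this makes the determinant $a^2 \det B$ obvious and the trace
  bilinear in $(c, d)$.
\<close>

definition sheared_sum :: "nat \<Rightarrow> 'a::field \<Rightarrow> 'a vec \<Rightarrow> 'a vec \<Rightarrow> 'a mat \<Rightarrow> 'a mat" where
  "sheared_sum m a c d B = shear m c d * hyp_sum m a B * transpose_mat (shear m c d)"

lemma block_carriers [simp]:
  "hyp_mat a \<in> carrier_mat 2 2"
  "two_cols m c d \<in> carrier_mat m 2"
  "wedge m c d \<in> carrier_mat m m"
  "shear m c d \<in> carrier_mat (Suc (Suc m)) (Suc (Suc m))"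
  "B \<in> carrier_mat m m \<Longrightarrow> hyp_sum m a B \<in> carrier_mat (Suc (Suc m)) (Suc (Suc m))"
proof -
  show C: "two_cols m c d \<in> carrier_mat m 2" "hyp_mat a \<in> carrier_mat 2 2"
    "wedge m c d \<in> carrier_mat m m"
    by (simp_all add: two_cols_def hyp_mat_def wedge_def)
  show "shear m c d \<in> carrier_mat (Suc (Suc m)) (Suc (Suc m))"
    using four_block_carrier_mat[of "1\<^sub>m 2" 2 2 "1\<^sub>m m" m m] by (simp add: shear_def)
  show "hyp_sum m a B \<in> carrier_mat (Suc (Suc m)) (Suc (Suc m))" if "B \<in> carrier_mat m m"
    using four_block_carrier_mat[OF C(2) that] by (simp add: hyp_sum_def)
qed

lemma shear_mult_block:
  assumes "A \<in> carrier_mat 2 2" "X \<in> carrier_mat 2 m" "Y \<in> carrier_mat m 2" "B \<in> carrier_mat m m"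
  shows "shear m c d * four_block_mat A X Y B * transpose_mat (shear m c d) =
    (let C = two_cols m c d in
     four_block_mat A (A * transpose_mat C + X) (C * A + Y)
       ((C * A + Y) * transpose_mat C + (C * X + B)))"
proof -
  let ?C = "two_cols m c d"
  have C: "?C \<in> carrier_mat m 2" "transpose_mat ?C \<in> carrier_mat 2 m" by simp_all
  have "shear m c d * four_block_mat A X Y B = four_block_mat A X (?C * A + Y) (?C * X + B)"
    unfolding shear_def
    by (subst mult_four_block_mat[of _ 2 2 _ m _ m _ _ 2 _ m]) (use assms C in simp_all)
  moreover have "transpose_mat (shear m c d) =
      four_block_mat (1\<^sub>m 2) (transpose_mat ?C) (0\<^sub>m m 2) (1\<^sub>m m)"
    unfolding shear_def by (subst transpose_four_block_mat[of _ 2 2 _ m _ m]) simp_all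
  moreover have "four_block_mat A X (?C * A + Y) (?C * X + B) *
      four_block_mat (1\<^sub>m 2) (transpose_mat ?C) (0\<^sub>m m 2) (1\<^sub>m m) =
      four_block_mat A (A * transpose_mat ?C + X) (?C * A + Y)
        ((?C * A + Y) * transpose_mat ?C + (?C * X + B))"
    by (subst mult_four_block_mat[of _ 2 2 _ m _ m _ _ 2 _ m]) (use assms C in simp_all)
  ultimately show ?thesis by (simp add: Let_def)
qed

lemma det_shear [simp]: "det (shear m c d) = 1"
  unfolding shear_def by (subst det_four_block_mat_upper_right_zero[of _ 2 _ m]) simp_all

lemma det_hyp_mat: "det (hyp_mat a) = a ^ 2"
  by (subst laplace_expansion_row[of _ 2 0])
     (simp_all add: hyp_mat_def cofactor_def mat_delete_def det_single numeral_2_eq_2)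

lemma det_hyp_sum: "B \<in> carrier_mat m m \<Longrightarrow> det (hyp_sum m a B) = a ^ 2 * det B"
  unfolding hyp_sum_def
  by (subst det_four_block_mat_upper_right_zero[of _ 2 _ m]) (simp_all add: det_hyp_mat)

lemma det_sheared_sum:
  assumes "B \<in> carrier_mat m m"
  shows "det (sheared_sum m a c d B) = a ^ 2 * det B"
proof -
  have S: "shear m c d \<in> carrier_mat (Suc (Suc m)) (Suc (Suc m))" by simp
  have H: "hyp_sum m a B \<in> carrier_mat (Suc (Suc m)) (Suc (Suc m))" using assms by simp
  show ?thesis
    unfolding sheared_sum_def det_mult[OF mult_carrier_mat[OF S H] transpose_carrier_mat[THEN iffD2, OF S]]
      det_mult[OF S H] det_transpose[OF S] det_hyp_sum[OF assms] by simp
qed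

text \<open>
  Multiplying out the congruence gives the entries of the matrix; from the off-diagonal blocks
  $c$ and $d$ can be read off, which is what makes the coordinates unique.
\<close>

lemma sheared_sum_eq_block:
  assumes B: "B \<in> carrier_mat m m"
  shows "sheared_sum m a c d B = four_block_mat (hyp_mat a)
    (mat 2 m (\<lambda>(i, j). if i = 0 then a * d $ j else - a * c $ j))
    (mat m 2 (\<lambda>(i, j). if j = 0 then - a * d $ i else a * c $ i))
    (a \<cdot>\<^sub>m wedge m c d + B)"
proof -
  let ?C = "two_cols m c d" and ?H = "hyp_mat a"
  have HC: "?H * transpose_mat ?C + 0\<^sub>m 2 m = mat 2 m (\<lambda>(i, j). if i = 0 then a * d $ j else - a * c $ j)"
    by (rule eq_matI) (auto simp: hyp_mat_def two_cols_def scalar_prod_def numeral_2_eq_2)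
  have CH: "?C * ?H + 0\<^sub>m m 2 = mat m 2 (\<lambda>(i, j). if j = 0 then - a * d $ i else a * c $ i)"
    by (rule eq_matI) (auto simp: hyp_mat_def two_cols_def scalar_prod_def numeral_2_eq_2)
  have W: "mat m 2 (\<lambda>(i, j). if j = 0 then - a * d $ i else a * c $ i) * transpose_mat ?C +
      (?C * 0\<^sub>m 2 m + B) = a \<cdot>\<^sub>m wedge m c d + B"
    using B by (intro eq_matI)
      (auto simp: wedge_def two_cols_def scalar_prod_def numeral_2_eq_2 algebra_simps)
  show ?thesis
    unfolding sheared_sum_def hyp_sum_def
    by (subst shear_mult_block[OF _ _ _ B]) (simp_all only: Let_def HC CH W block_carriers zero_carrier_mat)
qed

lemma sheared_sum_carrier [simp]:
  "B \<in> carrier_mat m m \<Longrightarrow> sheared_sum m a c d B \<in> carrier_mat (Suc (Suc m)) (Suc (Suc m))"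
  unfolding sheared_sum_def
  by (rule mult_carrier_mat[OF mult_carrier_mat[OF block_carriers(4)]])
    (rule block_carriers(5), assumption, simp)

lemma index_sheared_sum:
  assumes "B \<in> carrier_mat m m"
  shows "sheared_sum m a c d B $$ (0, Suc 0) = a"
    and "j < m \<Longrightarrow> sheared_sum m a c d B $$ (0, Suc (Suc j)) = a * d $ j"
    and "j < m \<Longrightarrow> sheared_sum m a c d B $$ (Suc 0, Suc (Suc j)) = - a * c $ j"
    and "i < m \<Longrightarrow> j < m \<Longrightarrow> sheared_sum m a c d B $$ (Suc (Suc i), Suc (Suc j)) =
           a * (c $ i * d $ j - d $ i * c $ j) + B $$ (i, j)"
    and "sheared_sum m a c d B $$ (0, 0) = 0"
    and "sheared_sum m a c d B $$ (Suc 0, 0) = - a"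
    and "sheared_sum m a c d B $$ (Suc 0, Suc 0) = 0"
    and "i < m \<Longrightarrow> sheared_sum m a c d B $$ (Suc (Suc i), 0) = - a * d $ i"
    and "i < m \<Longrightarrow> sheared_sum m a c d B $$ (Suc (Suc i), Suc 0) = a * c $ i"
  unfolding sheared_sum_eq_block[OF assms] using assms
  by (auto simp: hyp_mat_def wedge_def)

lemma hyp_sum_inv_alt_mats:
  assumes B: "B \<in> inv_alt_mats m" and a: "a \<noteq> 0"
  shows "hyp_sum m a B \<in> inv_alt_mats (Suc (Suc m))"
proof -
  note Bc = inv_alt_matsD(1)[OF B] and dB = inv_alt_matsD(2)[OF B] and Balt = inv_alt_matsD(3)[OF B]
  have "hyp_sum m a B $$ (j, i) = - hyp_sum m a B $$ (i, j)" if "i < Suc (Suc m)" "j < Suc (Suc m)" for i j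
  proof -
    have "B $$ (j - 2, i - 2) = - B $$ (i - 2, j - 2)" if "\<not> i < 2" "\<not> j < 2"
      using that \<open>i < Suc (Suc m)\<close> \<open>j < Suc (Suc m)\<close> by (intro Balt) auto
    then show ?thesis
      using that Bc by (auto simp: hyp_sum_def hyp_mat_def)
  qed
  moreover have "det (hyp_sum m a B) \<noteq> 0"
    using a dB by (simp add: det_hyp_sum[OF Bc])
  ultimately show ?thesis
    using block_carriers(5)[OF Bc] unfolding mem_inv_alt_mats_iff by blast
qed

lemma sheared_sum_inv_alt_mats:
  "B \<in> inv_alt_mats m \<Longrightarrow> a \<noteq> 0 \<Longrightarrow> sheared_sum m a c d B \<in> inv_alt_mats (Suc (Suc m))"
  unfolding sheared_sum_def by (intro congruence_inv_alt_mats hyp_sum_inv_alt_mats) simp_all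

text \<open>
  The elimination step.  The multipliers are the first two rows divided by the pivot $a$; the sign
  in $c$ comes from the lower left entry $-a$ of the hyperbolic plane.
\<close>

lemma inv_alt_mats_eq_sheared_sum:
  fixes A :: "'a::field mat"
  assumes two: "(2::'a) \<noteq> 0" and A: "A \<in> inv_alt_mats (Suc (Suc m))" and a: "A $$ (0, Suc 0) = a" "a \<noteq> 0"
    and c: "c = vec m (\<lambda>i. - A $$ (Suc 0, Suc (Suc i)) / a)"
    and d: "d = vec m (\<lambda>i. A $$ (0, Suc (Suc i)) / a)"
    and B: "B = mat m m (\<lambda>(i, j). A $$ (Suc (Suc i), Suc (Suc j)) - a * (c $ i * d $ j - d $ i * c $ j))"
  shows "A = sheared_sum m a c d B" and "B \<in> inv_alt_mats m"
proof -
  note Ac = inv_alt_matsD(1)[OF A] and dA = inv_alt_matsD(2)[OF A] and alt = inv_alt_matsD(3)[OF A]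
  note diag = inv_alt_mats_diag[OF two A]
  have Bc: "B \<in> carrier_mat m m" by (simp add: B)
  have cd: "a * c $ i = - A $$ (Suc 0, Suc (Suc i))" "a * d $ i = A $$ (0, Suc (Suc i))" if "i < m" for i
    using that a(2) by (simp_all add: c d)
  have Bij: "B $$ (i, j) = A $$ (Suc (Suc i), Suc (Suc j)) - a * (c $ i * d $ j - d $ i * c $ j)"
    if "i < m" "j < m" for i j
    using that by (simp add: B)
  have dims: "sheared_sum m a c d B \<in> carrier_mat (Suc (Suc m)) (Suc (Suc m))"
    using sheared_sum_carrier[OF Bc] .
  show eq: "A = sheared_sum m a c d B"
  proof (rule eq_matI)
    fix i j assume "i < dim_row (sheared_sum m a c d B)" "j < dim_col (sheared_sum m a c d B)"
    then have ij: "i < Suc (Suc m)" "j < Suc (Suc m)"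
      using dims by simp_all
    have split: "k = 0 \<or> k = Suc 0 \<or> (\<exists>k'<m. k = Suc (Suc k'))" if "k < Suc (Suc m)" for k
      using that by (metis Suc_less_eq not0_implies_Suc)
    show "A $$ (i, j) = sheared_sum m a c d B $$ (i, j)"
      using split[OF ij(1)] split[OF ij(2)]
    proof (elim disjE exE conjE)
    qed (simp_all add: index_sheared_sum[OF Bc] cd Bij a(1) diag alt[of 0 "Suc 0"]
        alt[of 0 "Suc (Suc _)"] alt[of "Suc 0" "Suc (Suc _)"])
  qed (use Ac dims in simp_all)
  have "det B \<noteq> 0"
    using dA unfolding eq det_sheared_sum[OF Bc] by simp
  moreover have "B $$ (j, i) = - B $$ (i, j)" if "i < m" "j < m" for i j
    using that alt[of "Suc (Suc i)" "Suc (Suc j)"] by (simp add: B algebra_simps)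
  ultimately show "B \<in> inv_alt_mats m"
    using Bc unfolding mem_inv_alt_mats_iff by blast
qed

section \<open>Traces and sums in block coordinates\<close>

lemma mat_trace_four_block_mat:
  assumes "A \<in> carrier_mat 2 2" "D \<in> carrier_mat m m"
  shows "mat_trace (four_block_mat A X Y D) = mat_trace A + mat_trace D"
proof -
  have "mat_trace (four_block_mat A X Y D) = (\<Sum>i<Suc (Suc m). four_block_mat A X Y D $$ (i, i))"
    using assms by (simp add: mat_trace_def)
  also have "\<dots> = A $$ (0, 0) + (A $$ (Suc 0, Suc 0) + (\<Sum>i<m. D $$ (i, i)))"
    unfolding sum.lessThan_Suc_shift using assms by simp
  also have "\<dots> = mat_trace A + mat_trace D"
    using assms by (simp add: mat_trace_def numeral_2_eq_2 add.assoc)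
  finally show ?thesis .
qed

lemma mat_trace_mult_hyp_sum:
  assumes "A \<in> carrier_mat 2 2" "X \<in> carrier_mat 2 m" "Y \<in> carrier_mat m 2"
    and "B \<in> carrier_mat m m" "T \<in> carrier_mat m m"
  shows "mat_trace (four_block_mat A X Y B * hyp_sum m t T) =
    mat_trace (A * hyp_mat t) + mat_trace (B * T)"
proof -
  have "four_block_mat A X Y B * hyp_sum m t T = four_block_mat (A * hyp_mat t + X * 0\<^sub>m m 2)
      (A * 0\<^sub>m 2 m + X * T) (Y * hyp_mat t + B * 0\<^sub>m m 2) (Y * 0\<^sub>m 2 m + B * T)"
    unfolding hyp_sum_def by (rule mult_four_block_mat[of _ 2 2 _ m _ m _ _ 2 _ m]) (use assms in simp_all)
  also have "\<dots> = four_block_mat (A * hyp_mat t) (A * 0\<^sub>m 2 m + X * T) (Y * hyp_mat t + B * 0\<^sub>m m 2) (B * T)"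
    using assms by (simp add: mult_carrier_mat[of _ 2 2 _ 2] mult_carrier_mat[of _ m m _ m])
  also have "mat_trace \<dots> = mat_trace (A * hyp_mat t) + mat_trace (B * T)"
    using assms
    by (intro mat_trace_four_block_mat[of _ _ m] mult_carrier_mat[of _ 2 2 _ 2] mult_carrier_mat[of _ m m _ m]) simp_all
  finally show ?thesis .
qed

lemma scalar_prod_mult_mat_vec:
  assumes "T \<in> carrier_mat m m" "c \<in> carrier_vec m" "d \<in> carrier_vec m"
  shows "c \<bullet> (T *\<^sub>v d) = (\<Sum>i<m. \<Sum>j<m. c $ i * T $$ (i, j) * d $ j)"
  using assms by (simp add: scalar_prod_def sum_distrib_left mult.assoc atLeast0LessThan)

text \<open>
  Both terms of $c d^T - d c^T$ contribute the same amount because $T$ is alternating, whence the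
  factor $2$.
\<close>

lemma mat_trace_wedge:
  fixes T :: "'a::field mat"
  assumes T: "T \<in> inv_alt_mats m" and cd: "c \<in> carrier_vec m" "d \<in> carrier_vec m"
  shows "mat_trace (wedge m c d * T) = - 2 * (c \<bullet> (T *\<^sub>v d))"
proof -
  note Tc = inv_alt_matsD(1)[OF T]
  have "mat_trace (wedge m c d * T) = (\<Sum>i<m. \<Sum>j<m. (c $ i * d $ j - d $ i * c $ j) * T $$ (j, i))"
    unfolding mat_trace_mult[OF block_carriers(3) Tc] by (simp add: wedge_def)
  also have "\<dots> = (\<Sum>i<m. \<Sum>j<m. - (c $ i * T $$ (i, j) * d $ j) - c $ j * T $$ (j, i) * d $ i)"
  proof (intro sum.cong refl)
    fix i j assume "i \<in> {..<m}" "j \<in> {..<m}"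
    then have "T $$ (i, j) = - T $$ (j, i)" by (intro inv_alt_matsD(3)[OF T]) simp_all
    then show "(c $ i * d $ j - d $ i * c $ j) * T $$ (j, i)
        = - (c $ i * T $$ (i, j) * d $ j) - c $ j * T $$ (j, i) * d $ i"
      by (simp only:) (simp add: algebra_simps)
  qed
  also have "\<dots> = - (c \<bullet> (T *\<^sub>v d)) - (\<Sum>i<m. \<Sum>j<m. c $ j * T $$ (j, i) * d $ i)"
    by (simp add: scalar_prod_mult_mat_vec[OF Tc cd] sum_subtractf sum_negf)
  also have "(\<Sum>i<m. \<Sum>j<m. c $ j * T $$ (j, i) * d $ i) = c \<bullet> (T *\<^sub>v d)"
    unfolding scalar_prod_mult_mat_vec[OF Tc cd] by (rule sum.swap)
  finally show ?thesis by simp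
qed

lemma mat_trace_smult_add_mult:
  fixes T :: "'a::field mat"
  assumes "W \<in> carrier_mat m m" "B \<in> carrier_mat m m" "T \<in> carrier_mat m m"
  shows "mat_trace ((a \<cdot>\<^sub>m W + B) * T) = a * mat_trace (W * T) + mat_trace (B * T)"
proof -
  have WB: "a \<cdot>\<^sub>m W + B \<in> carrier_mat m m" using assms by simp
  show ?thesis
    unfolding mat_trace_mult[OF WB assms(3)] mat_trace_mult[OF assms(1,3)] mat_trace_mult[OF assms(2,3)]
    using assms by (simp add: distrib_right sum.distrib sum_distrib_left mult.assoc)
qed

lemma mat_trace_sheared_sum:
  fixes T :: "'a::field mat"
  assumes T: "T \<in> inv_alt_mats m" and B: "B \<in> carrier_mat m m"
    and cd: "c \<in> carrier_vec m" "d \<in> carrier_vec m"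
  shows "mat_trace (sheared_sum m a c d B * hyp_sum m t T) =
    - 2 * a * t + mat_trace (B * T) + - 2 * a * (c \<bullet> (T *\<^sub>v d))"
proof -
  note Tc = inv_alt_matsD(1)[OF T]
  have "mat_trace (hyp_mat a * hyp_mat t) = - 2 * a * t"
    unfolding mat_trace_mult[OF block_carriers(1,1)] by (simp add: hyp_mat_def numeral_2_eq_2)
  then show ?thesis
    unfolding sheared_sum_eq_block[OF B]
    by (subst mat_trace_mult_hyp_sum[OF _ _ _ _ Tc])
      (use B in \<open>simp_all add: mat_trace_smult_add_mult[OF _ B Tc] mat_trace_wedge[OF T cd]\<close>)
qed

text \<open>
  The block coordinates turn a sum over matrices with nonzero pivot into an iterated sum over
  independent variables.
\<close>

lemma sum_sheared_sum:
  fixes f :: "'a::{field,finite} mat \<Rightarrow> complex"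
  assumes two: "(2::'a) \<noteq> 0"
  shows "(\<Sum>A\<in>{A\<in>inv_alt_mats (Suc (Suc m)). A $$ (0, Suc 0) \<noteq> 0}. f A) =
    (\<Sum>a\<in>{a. a \<noteq> 0}. \<Sum>c\<in>carrier_vec m. \<Sum>d\<in>carrier_vec m. \<Sum>B\<in>inv_alt_mats m.
       f (sheared_sum m a c d B))"
proof -
  let ?N = "{a::'a. a \<noteq> 0}" and ?V = "carrier_vec m :: 'a vec set" and ?I = "inv_alt_mats m :: 'a mat set"
  define p :: "'a \<times> 'a vec \<times> 'a vec \<times> 'a mat \<Rightarrow> 'a mat"
    where "p = (\<lambda>(a, c, d, B). sheared_sum m a c d B)"
  define a where "a A = A $$ (0, Suc 0)" for A :: "'a mat"
  define c where "c A = vec m (\<lambda>i. - A $$ (Suc 0, Suc (Suc i)) / a A)" for A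
  define d where "d A = vec m (\<lambda>i. A $$ (0, Suc (Suc i)) / a A)" for A
  define B where "B A = mat m m (\<lambda>(i, j). A $$ (Suc (Suc i), Suc (Suc j)) -
     a A * (c A $ i * d A $ j - d A $ i * c A $ j))" for A
  have "(\<Sum>x\<in>?N \<times> ?V \<times> ?V \<times> ?I. f (p x)) =
      (\<Sum>A\<in>{A\<in>inv_alt_mats (Suc (Suc m)). A $$ (0, Suc 0) \<noteq> 0}. f A)"
  proof (rule sum.reindex_bij_witness[where j = p and i = "\<lambda>A. (a A, c A, d A, B A)"])
    fix A :: "'a mat" assume A: "A \<in> {A\<in>inv_alt_mats (Suc (Suc m)). A $$ (0, Suc 0) \<noteq> 0}"
    then have I: "A \<in> inv_alt_mats (Suc (Suc m))" and nz: "a A \<noteq> 0" by (simp_all add: a_def)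
    note eq = inv_alt_mats_eq_sheared_sum[OF two I a_def[symmetric] nz c_def d_def B_def]
    show "p (a A, c A, d A, B A) = A" using eq(1) by (simp add: p_def)
    show "(a A, c A, d A, B A) \<in> ?N \<times> ?V \<times> ?V \<times> ?I"
      using eq(2) nz by (simp add: c_def d_def)
  next
    fix x assume "x \<in> ?N \<times> ?V \<times> ?V \<times> ?I"
    then obtain a' c' d' B' where x: "x = (a', c', d', B')" and a': "a' \<noteq> 0"
      and cd': "c' \<in> ?V" "d' \<in> ?V" and B': "B' \<in> ?I"
      by auto
    note B'c = inv_alt_matsD(1)[OF B']
    define S where "S = sheared_sum m a' c' d' B'"
    note S_index = index_sheared_sum[OF B'c, where a = a' and c = c' and d = d', folded S_def]
    have px: "p x = S" by (simp add: p_def x S_def)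
    have "S \<in> inv_alt_mats (Suc (Suc m))"
      unfolding S_def by (rule sheared_sum_inv_alt_mats[OF B' a'])
    then show "p x \<in> {A\<in>inv_alt_mats (Suc (Suc m)). A $$ (0, Suc 0) \<noteq> 0}"
      using a' by (simp add: px S_index)
    have aa: "a S = a'" by (simp add: a_def S_index)
    have cc: "c S = c'"
      using cd' a' by (intro eq_vecI) (simp_all add: c_def aa S_index)
    have dd: "d S = d'"
      using cd' a' by (intro eq_vecI) (simp_all add: d_def aa S_index)
    have BB: "B S = B'"
      unfolding B_def aa cc dd
      using B'c by (intro eq_matI) (simp_all add: S_index)
    show "(a (p x), c (p x), d (p x), B (p x)) = x"
      unfolding px aa cc dd BB by (rule x[symmetric])
  qed simp
  then show ?thesis
    by (simp add: p_def sum.cartesian_product case_prod_unfold)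
qed

section \<open>Matrices with vanishing pivot contribute nothing\<close>

lemma mult_mat_vec_inv_alt_mats_eq_0_iff:
  fixes T :: "'a::field mat"
  assumes "T \<in> inv_alt_mats m" "v \<in> carrier_vec m"
  shows "T *\<^sub>v v = 0\<^sub>v m \<longleftrightarrow> v = 0\<^sub>v m"
proof
  assume "T *\<^sub>v v = 0\<^sub>v m"
  then show "v = 0\<^sub>v m"
    using det_0_iff_vec_prod_zero[OF inv_alt_matsD(1)[OF assms(1)]] inv_alt_matsD(2)[OF assms(1)] assms(2)
    by blast
next
  assume "v = 0\<^sub>v m"
  then show "T *\<^sub>v v = 0\<^sub>v m"
    using inv_alt_matsD(1)[OF assms(1)] by (intro eq_vecI) simp_all
qed

text \<open>
  Otherwise the first column would vanish as well, and $A$ would kill the first unit vector.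
\<close>

lemma first_row_nonzero:
  fixes A :: "'a::field mat"
  assumes two: "(2::'a) \<noteq> 0" and A: "A \<in> inv_alt_mats (Suc m)"
  shows "\<exists>j<m. A $$ (0, Suc j) \<noteq> 0"
proof (rule ccontr)
  assume *: "\<not> ?thesis"
  note Ac = inv_alt_matsD(1)[OF A]
  have row: "A $$ (0, i) = 0" if "i < Suc m" for i
    using that * inv_alt_mats_diag[OF two A, of 0] by (cases i) auto
  have "A *\<^sub>v unit_vec (Suc m) 0 = 0\<^sub>v (Suc m)"
  proof (rule eq_vecI)
    fix i assume "i < dim_vec (0\<^sub>v (Suc m) :: 'a vec)"
    then have i: "i < Suc m" by simp
    then have "A $$ (i, 0) = - A $$ (0, i)" by (intro inv_alt_matsD(3)[OF A]) simp_all
    then show "(A *\<^sub>v unit_vec (Suc m) 0) $ i = 0\<^sub>v (Suc m) $ i"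
      using i Ac row[OF i] by simp
  qed (use Ac in simp)
  then have "unit_vec (Suc m) 0 = (0\<^sub>v (Suc m) :: 'a vec)"
    using mult_mat_vec_inv_alt_mats_eq_0_iff[OF A] by simp
  then have "unit_vec (Suc m) 0 $ 0 = (0\<^sub>v (Suc m) :: 'a vec) $ 0" by simp
  then show False by simp
qed

text \<open>
  When the pivot $A_{01}$ vanishes, adding $u_i$ times row and column $0$ to row and column $i + 2$
  leaves the first two rows unchanged and adds $u w^T - w u^T$ to the lower right block, where $w$
  is the remaining part of row $0$.
\<close>

lemma mat_trace_shear_mult_hyp_sum:
  fixes A T :: "'a::field mat"
  assumes two: "(2::'a) \<noteq> 0" and A: "A \<in> inv_alt_mats (Suc (Suc m))" and A01: "A $$ (0, Suc 0) = 0"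
    and T: "T \<in> inv_alt_mats m" and u: "u \<in> carrier_vec m"
    and w: "w = vec m (\<lambda>j. A $$ (0, Suc (Suc j)))"
  defines "L \<equiv> shear m u (0\<^sub>v m)"
  shows "mat_trace (L * A * transpose_mat L * hyp_sum m t T) =
      mat_trace (A * hyp_sum m t T) + - 2 * (u \<bullet> (T *\<^sub>v w))"
    and "(L * A * transpose_mat L) $$ (0, Suc 0) = 0"
proof -
  note Ac = inv_alt_matsD(1)[OF A] and alt = inv_alt_matsD(3)[OF A] and Tc = inv_alt_matsD(1)[OF T]
  let ?C = "two_cols m u (0\<^sub>v m)"
  define X where "X = mat 2 m (\<lambda>(i, j). A $$ (i, Suc (Suc j)))"
  define Y where "Y = mat m 2 (\<lambda>(i, j). A $$ (Suc (Suc i), j))"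
  define B where "B = mat m m (\<lambda>(i, j). A $$ (Suc (Suc i), Suc (Suc j)))"
  note diag = inv_alt_mats_diag[OF two A]
  have c: "X \<in> carrier_mat 2 m" "Y \<in> carrier_mat m 2" "B \<in> carrier_mat m m" "(0\<^sub>m 2 2 :: 'a mat) \<in> carrier_mat 2 2"
    by (simp_all add: X_def Y_def B_def)
  have Ablock: "A = four_block_mat (0\<^sub>m 2 2) X Y B"
  proof (rule eq_matI)
    fix i j assume "i < dim_row (four_block_mat (0\<^sub>m 2 2) X Y B)" "j < dim_col (four_block_mat (0\<^sub>m 2 2) X Y B)"
    then have ij: "i < Suc (Suc m)" "j < Suc (Suc m)" by (simp_all add: B_def)
    have "A $$ (Suc 0, 0) = 0" using alt[of 0 "Suc 0"] A01 by simp
    then have "A $$ (i, j) = 0" if "i < 2" "j < 2"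
      using that A01 diag[of 0] diag[of "Suc 0"] by (auto simp: less_2_cases_iff)
    then show "A $$ (i, j) = four_block_mat (0\<^sub>m 2 2) X Y B $$ (i, j)"
      using ij by (auto simp: X_def Y_def B_def Suc_diff_Suc numeral_2_eq_2 not_less Suc_le_eq)
  qed (use Ac in \<open>simp_all add: B_def\<close>)
  have X_eq: "0\<^sub>m 2 2 * transpose_mat ?C + X = X" and Y_eq: "?C * 0\<^sub>m 2 2 + Y = Y"
    using c by (simp_all add: left_mult_zero_mat[of _ 2 m] right_mult_zero_mat[of _ m 2])
  have "Y * transpose_mat ?C + (?C * X + B) = wedge m u w + B"
  proof (rule eq_matI)
    fix i j assume "i < dim_row (wedge m u w + B)" "j < dim_col (wedge m u w + B)"
    then have ij: "i < m" "j < m" by (simp_all add: B_def)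
    then have "A $$ (Suc (Suc i), 0) = - A $$ (0, Suc (Suc i))" by (intro alt) simp_all
    then show "(Y * transpose_mat ?C + (?C * X + B)) $$ (i, j) = (wedge m u w + B) $$ (i, j)"
      using ij
      by (simp add: X_def Y_def B_def wedge_def two_cols_def w scalar_prod_def numeral_2_eq_2)
  qed (simp_all add: X_def Y_def B_def wedge_def two_cols_def)
  then have LAL: "L * A * transpose_mat L = four_block_mat (0\<^sub>m 2 2) X Y (wedge m u w + B)"
    unfolding L_def Ablock shear_mult_block[OF c(4,1,2,3)] Let_def X_eq Y_eq by simp
  have "mat_trace ((wedge m u w + B) * T) = mat_trace (wedge m u w * T) + mat_trace (B * T)"
  proof -
    have "1 \<cdot>\<^sub>m wedge m u w = wedge m u w" by (rule eq_matI) simp_all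
    then show ?thesis
      using mat_trace_smult_add_mult[of "wedge m u w" m B T 1] c Tc by simp
  qed
  moreover have "mat_trace (wedge m u w * T) = - 2 * (u \<bullet> (T *\<^sub>v w))"
    by (rule mat_trace_wedge[OF T u]) (simp add: w)
  moreover have WB: "wedge m u w + B \<in> carrier_mat m m" using c by simp
  ultimately show "mat_trace (L * A * transpose_mat L * hyp_sum m t T) =
      mat_trace (A * hyp_sum m t T) + - 2 * (u \<bullet> (T *\<^sub>v w))"
    unfolding LAL mat_trace_mult_hyp_sum[OF c(4,1,2) WB Tc]
    unfolding Ablock mat_trace_mult_hyp_sum[OF c(4,1,2,3) Tc] by simp
  show "(L * A * transpose_mat L) $$ (0, Suc 0) = 0"
    unfolding LAL by simp
qed

text \<open>
  The shears with parameter $u$ permute the matrices with zero pivot, preserve the determinant and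
  multiply the summand at $A$ by $\psi(-2\, u \cdot T w)$.  Averaging over all $u$ gives zero,
  because $w \ne 0$ (it is all that is left of the first row of an invertible matrix) and hence
  $T w \ne 0$.
\<close>

lemma sum_off_pivot_eq_0:
  fixes \<omega> \<psi> :: "'a::{field,finite} \<Rightarrow> complex" and T :: "'a mat"
  assumes two: "(2::'a) \<noteq> 0" and \<psi>: "add_character \<psi>" "\<psi> \<noteq> (\<lambda>_. 1)"
    and T: "T \<in> inv_alt_mats m"
  shows "(\<Sum>A\<in>{A\<in>inv_alt_mats (Suc (Suc m)). A $$ (0, Suc 0) = 0}.
      \<omega> (det A) * \<psi> (mat_trace (A * hyp_sum m t T))) = 0"
proof -
  let ?I = "{A\<in>inv_alt_mats (Suc (Suc m)). A $$ (0, Suc 0) = 0} :: 'a mat set"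
  let ?V = "carrier_vec m :: 'a vec set"
  define f where "f A = \<omega> (det A) * \<psi> (mat_trace (A * hyp_sum m t T))" for A
  define w where "w A = vec m (\<lambda>j. A $$ (0, Suc (Suc j)))" for A :: "'a mat"
  define v where "v A = (- 2) \<cdot>\<^sub>v (T *\<^sub>v w A)" for A
  note Tc = inv_alt_matsD(1)[OF T]
  have vc: "v A \<in> ?V" and wc: "w A \<in> ?V" for A using Tc by (auto simp: v_def w_def)
  have shift: "(\<Sum>A\<in>?I. f A) = (\<Sum>A\<in>?I. f A * \<psi> (u \<bullet> v A))" if u: "u \<in> ?V" for u
  proof -
    define L where "L = shear m u (0\<^sub>v m)"
    have L: "L \<in> carrier_mat (Suc (Suc m)) (Suc (Suc m))" "det L = 1" "det L \<noteq> 0"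
      by (simp_all add: L_def)
    let ?g = "\<lambda>A. L * A * transpose_mat L"
    have "inj_on ?g ?I"
      by (rule inj_on_subset[OF bij_betw_imp_inj_on[OF bij_betw_congruence[OF L(1,3)]]]) auto
    moreover have "?g ` ?I \<subseteq> ?I"
    proof (rule image_subsetI)
      fix A assume "A \<in> ?I"
      then have "A \<in> inv_alt_mats (Suc (Suc m))" "A $$ (0, Suc 0) = 0" by simp_all
      then show "?g A \<in> ?I"
        using congruence_inv_alt_mats(1)[OF _ L(1,3)]
          mat_trace_shear_mult_hyp_sum(2)[OF two _ _ T u w_def, folded L_def] by blast
    qed
    moreover have fin: "finite ?I" by (rule finite_subset[OF _ finite_inv_alt_mats]) blast
    ultimately have bij: "bij_betw ?g ?I ?I"
      using endo_inj_surj[OF fin] by (simp add: bij_betw_def)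
    have "(\<Sum>A\<in>?I. f A) = (\<Sum>A\<in>?I. f (?g A))"
      by (rule sum.reindex_bij_betw[OF bij, symmetric])
    also have "\<dots> = (\<Sum>A\<in>?I. f A * \<psi> (u \<bullet> v A))"
    proof (rule sum.cong[OF refl])
      fix A assume "A \<in> ?I"
      then have A: "A \<in> inv_alt_mats (Suc (Suc m))" "A $$ (0, Suc 0) = 0" by simp_all
      have uv: "u \<bullet> v A = - 2 * (u \<bullet> (T *\<^sub>v w A))"
        unfolding v_def by (rule scalar_prod_smult_right) (use u Tc in simp)
      have "det (?g A) = det A"
        using congruence_inv_alt_mats(2)[OF A(1) L(1,3)] L(2) by simp
      moreover have "mat_trace (?g A * hyp_sum m t T) = mat_trace (A * hyp_sum m t T) + u \<bullet> v A"
        using mat_trace_shear_mult_hyp_sum(1)[OF two A T u w_def, folded L_def] uv by simp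
      ultimately show "f (?g A) = f A * \<psi> (u \<bullet> v A)"
        using \<psi>(1) unfolding f_def add_character_def by simp
    qed
    finally show ?thesis .
  qed
  have v0: "v A \<noteq> 0\<^sub>v m" if "A \<in> ?I" for A
  proof
    assume v: "v A = 0\<^sub>v m"
    have "T *\<^sub>v w A = 0\<^sub>v m"
    proof (rule eq_vecI)
      fix i assume "i < dim_vec (0\<^sub>v m :: 'a vec)"
      then have i: "i < m" by simp
      have "v A $ i = 0" using i v by simp
      then have "(- 2) * (T *\<^sub>v w A) $ i = 0" using i Tc unfolding v_def by simp
      then show "(T *\<^sub>v w A) $ i = 0\<^sub>v m $ i" using two i by simp
    qed (use Tc in simp)
    then have w0: "w A = 0\<^sub>v m"
      using mult_mat_vec_inv_alt_mats_eq_0_iff[OF T wc] by simp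
    from that have A: "A \<in> inv_alt_mats (Suc (Suc m))" "A $$ (0, Suc 0) = 0" by simp_all
    obtain j where j: "j < Suc m" "A $$ (0, Suc j) \<noteq> 0"
      using first_row_nonzero[OF two A(1)] by blast
    with A(2) obtain k where k: "j = Suc k" "k < m" by (cases j) auto
    have "w A $ k = A $$ (0, Suc j)" using k by (simp add: w_def)
    then show False using w0 j k by simp
  qed
  have "of_nat (card ?V) * (\<Sum>A\<in>?I. f A) = (\<Sum>u\<in>?V. \<Sum>A\<in>?I. f A)"
    by simp
  also have "\<dots> = (\<Sum>u\<in>?V. \<Sum>A\<in>?I. f A * \<psi> (u \<bullet> v A))"
    by (rule sum.cong[OF refl shift])
  also have "\<dots> = (\<Sum>A\<in>?I. f A * (\<Sum>u\<in>?V. \<psi> (u \<bullet> v A)))"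
    unfolding sum_distrib_left by (rule sum.swap)
  also have "\<dots> = 0"
    by (rule sum.neutral, rule ballI) (simp add: sum_add_character_scalar_prod[OF \<psi> vc] v0)
  finally show ?thesis
    by (simp add: card_carrier_vec f_def)
qed

section \<open>Recursion for a nontrivial additive character\<close>

lemma mult_characterD:
  assumes "mult_character \<omega>"
  shows "a \<noteq> 0 \<Longrightarrow> \<omega> a \<noteq> 0"
    and "a \<noteq> 0 \<Longrightarrow> b \<noteq> 0 \<Longrightarrow> \<omega> (a * b) = \<omega> a * \<omega> b"
    and "\<omega> 1 = 1"
    and "a \<noteq> 0 \<Longrightarrow> \<omega> (a ^ 2) = \<omega> a ^ 2"
proof -
  show *: "\<omega> (a * b) = \<omega> a * \<omega> b" if "a \<noteq> 0" "b \<noteq> 0" for a b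
    using assms that unfolding mult_character_def by blast
  show nz: "\<omega> a \<noteq> 0" if "a \<noteq> 0" for a
    using assms that unfolding mult_character_def by blast
  have "\<omega> 1 = \<omega> 1 * \<omega> 1" using *[of 1 1] by simp
  then show "\<omega> 1 = 1" using nz[of 1] by simp
  show "\<omega> (a ^ 2) = \<omega> a ^ 2" if "a \<noteq> 0" for a
    using *[OF that that] by (simp add: power2_eq_square)
qed

lemma add_characterD:
  assumes "add_character \<psi>"
  shows "\<psi> (a + b) = \<psi> a * \<psi> b" and "\<psi> 0 = 1"
proof -
  show *: "\<psi> (a + b) = \<psi> a * \<psi> b" for a b
    using assms unfolding add_character_def by blast
  have "\<psi> 0 = \<psi> 0 * \<psi> 0" using *[of 0 0] by simp
  then show "\<psi> 0 = 1" using assms unfolding add_character_def by simp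
qed

text \<open>
  Substitute $b = -a t$; the sign disappears because $\omega(-1)^2 = \omega(1) = 1$.
\<close>

lemma sum_mult_character_scaled:
  fixes \<omega> \<psi> :: "'a::{field,finite} \<Rightarrow> complex"
  assumes \<omega>: "mult_character \<omega>" and \<psi>: "add_character \<psi>" and t: "t \<noteq> 0"
  shows "(\<Sum>a\<in>{a. a \<noteq> 0}. \<omega> (a ^ 2) * \<psi> (- 2 * a * t)) =
    gauss_sum (\<lambda>a. \<omega> a ^ 2) (\<lambda>a. \<psi> a ^ 2) / \<omega> (t ^ 2)"
proof -
  note \<omega> = mult_characterD[OF \<omega>] and \<psi> = add_characterD[OF \<psi>]
  have m1: "\<omega> (- 1) ^ 2 = 1" using \<omega>(4)[of "- 1"] \<omega>(3) by simp
  have "gauss_sum (\<lambda>a. \<omega> a ^ 2) (\<lambda>a. \<psi> a ^ 2) =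
      (\<Sum>a\<in>{a. a \<noteq> 0}. \<omega> (- 1 * (a * t)) ^ 2 * \<psi> (- 1 * (a * t)) ^ 2)"
    unfolding gauss_sum_def
    by (rule sum.reindex_bij_witness[where i = "\<lambda>a. - 1 * (a * t)" and j = "\<lambda>b. - b / t"])
      (use t in auto)
  also have "\<dots> = (\<Sum>a\<in>{a. a \<noteq> 0}. \<omega> (t ^ 2) * (\<omega> (a ^ 2) * \<psi> (- 2 * a * t)))"
  proof (rule sum.cong[OF refl])
    fix a :: 'a assume "a \<in> {a. a \<noteq> 0}"
    then have a: "a \<noteq> 0" by simp
    have "\<omega> (- 1 * (a * t)) = \<omega> (- 1) * (\<omega> a * \<omega> t)"
      using a t \<omega>(2)[of "- 1" "a * t"] \<omega>(2)[OF a t] by simp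
    then have "\<omega> (- 1 * (a * t)) ^ 2 = \<omega> (t ^ 2) * \<omega> (a ^ 2)"
      using m1 by (simp add: \<omega>(4)[OF a] \<omega>(4)[OF t] power_mult_distrib)
    moreover have "\<psi> (- 2 * a * t) = \<psi> (- 1 * (a * t) + - 1 * (a * t))"
      by (rule arg_cong[of _ _ \<psi>]) (simp add: algebra_simps)
    then have "\<psi> (- 1 * (a * t)) ^ 2 = \<psi> (- 2 * a * t)"
      unfolding \<psi>(1) by (simp add: power2_eq_square)
    ultimately show "\<omega> (- 1 * (a * t)) ^ 2 * \<psi> (- 1 * (a * t)) ^ 2
        = \<omega> (t ^ 2) * (\<omega> (a ^ 2) * \<psi> (- 2 * a * t))"
      by simp
  qed
  finally show ?thesis
    using \<omega>(1)[of "t ^ 2"] t by (simp add: sum_distrib_left[symmetric])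
qed

text \<open>
  By orthogonality the sum over $c$ vanishes unless $T d = 0$, that is unless $d = 0$.
\<close>

lemma sum_add_character_bilinear:
  fixes \<psi> :: "'a::{field,finite} \<Rightarrow> complex"
  assumes \<psi>: "add_character \<psi>" "\<psi> \<noteq> (\<lambda>_. 1)" and T: "T \<in> inv_alt_mats m" and k: "k \<noteq> 0"
  shows "(\<Sum>c\<in>carrier_vec m. \<Sum>d\<in>carrier_vec m. \<psi> (k * (c \<bullet> (T *\<^sub>v d)))) = of_nat CARD('a) ^ m"
proof -
  note Tc = inv_alt_matsD(1)[OF T]
  have "(\<Sum>c\<in>carrier_vec m. \<Sum>d\<in>carrier_vec m. \<psi> (k * (c \<bullet> (T *\<^sub>v d)))) =
      (\<Sum>d\<in>carrier_vec m. \<Sum>c\<in>carrier_vec m. \<psi> (k * (c \<bullet> (T *\<^sub>v d))))"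
    by (rule sum.swap)
  also have "\<dots> = (\<Sum>d\<in>carrier_vec m. if d = (0\<^sub>v m :: 'a vec) then of_nat CARD('a) ^ m else 0)"
  proof (rule sum.cong[OF refl])
    fix d :: "'a vec" assume d: "d \<in> carrier_vec m"
    have kd: "k \<cdot>\<^sub>v d \<in> carrier_vec m" using d by simp
    have "k \<cdot>\<^sub>v d = 0\<^sub>v m \<longleftrightarrow> d = 0\<^sub>v m"
      using k d by (auto simp: vec_eq_iff)
    then have "T *\<^sub>v (k \<cdot>\<^sub>v d) = 0\<^sub>v m \<longleftrightarrow> d = 0\<^sub>v m"
      using mult_mat_vec_inv_alt_mats_eq_0_iff[OF T kd] by simp
    moreover have "k * (c \<bullet> (T *\<^sub>v d)) = c \<bullet> (T *\<^sub>v (k \<cdot>\<^sub>v d))" if "c \<in> carrier_vec m" for c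
      using that d Tc by (simp add: mult_mat_vec[OF Tc d])
    ultimately show "(\<Sum>c\<in>carrier_vec m. \<psi> (k * (c \<bullet> (T *\<^sub>v d)))) =
        (if d = 0\<^sub>v m then of_nat CARD('a) ^ m else 0)"
      using sum_add_character_scalar_prod[OF \<psi>, of "T *\<^sub>v (k \<cdot>\<^sub>v d)" m] Tc kd by simp
  qed
  also have "\<dots> = of_nat CARD('a) ^ m"
    by (simp add: finite_carrier_vec)
  finally show ?thesis .
qed

text \<open>
  Only the matrices with nonzero pivot contribute.  In block coordinates their contribution is a
  product of a classical Gauss sum over $a$, a bilinear character sum over $(c, d)$, and the
  alternating Gauss sum over the Schur complement $B$.
\<close>

lemma alt_gauss_sum_hyp_sum:
  fixes \<omega> \<psi> :: "'a::{field,finite} \<Rightarrow> complex"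
  assumes two: "(2::'a) \<noteq> 0" and \<omega>: "mult_character \<omega>"
    and \<psi>: "add_character \<psi>" "\<psi> \<noteq> (\<lambda>_. 1)"
    and t: "t \<noteq> 0" and T: "T \<in> inv_alt_mats m"
  shows "alt_gauss_sum (Suc (Suc m)) \<omega> \<psi> (hyp_sum m t T) =
    of_nat CARD('a) ^ m * (gauss_sum (\<lambda>a. \<omega> a ^ 2) (\<lambda>a. \<psi> a ^ 2) / \<omega> (t ^ 2)) * alt_gauss_sum m \<omega> \<psi> T"
proof -
  let ?I = "inv_alt_mats (Suc (Suc m)) :: 'a mat set" and ?V = "carrier_vec m :: 'a vec set"
  define f where "f A = \<omega> (det A) * \<psi> (mat_trace (A * hyp_sum m t T))" for A
  define G where "G = alt_gauss_sum m \<omega> \<psi> T"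
  have "alt_gauss_sum (Suc (Suc m)) \<omega> \<psi> (hyp_sum m t T) = (\<Sum>A\<in>?I. f A)"
    by (simp add: alt_gauss_sum_def f_def)
  also have "?I = {A\<in>?I. A $$ (0, Suc 0) \<noteq> 0} \<union> {A\<in>?I. A $$ (0, Suc 0) = 0}" by blast
  also have "(\<Sum>A\<in>\<dots>. f A) = (\<Sum>A\<in>{A\<in>?I. A $$ (0, Suc 0) \<noteq> 0}. f A) + (\<Sum>A\<in>{A\<in>?I. A $$ (0, Suc 0) = 0}. f A)"
    by (rule sum.union_disjoint; (rule finite_subset[OF _ finite_inv_alt_mats])?) blast+
  also have "(\<Sum>A\<in>{A\<in>?I. A $$ (0, Suc 0) = 0}. f A) = 0"
    unfolding f_def by (rule sum_off_pivot_eq_0[OF two \<psi> T])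
  also have "(\<Sum>A\<in>{A\<in>?I. A $$ (0, Suc 0) \<noteq> 0}. f A) =
      (\<Sum>a\<in>{a. a \<noteq> 0}. \<Sum>c\<in>?V. \<Sum>d\<in>?V. \<Sum>B\<in>inv_alt_mats m. f (sheared_sum m a c d B))"
    by (rule sum_sheared_sum[OF two])
  also have "\<dots> = (\<Sum>a\<in>{a. a \<noteq> 0}. \<Sum>c\<in>?V. \<Sum>d\<in>?V. \<Sum>B\<in>inv_alt_mats m.
      (\<omega> (a ^ 2) * \<psi> (- 2 * a * t)) * \<psi> (- 2 * a * (c \<bullet> (T *\<^sub>v d))) *
      (\<omega> (det B) * \<psi> (mat_trace (B * T))))"
  proof (intro sum.cong refl)
    fix a :: 'a and c d :: "'a vec" and B :: "'a mat"
    assume "a \<in> {a. a \<noteq> 0}" and cd: "c \<in> ?V" "d \<in> ?V" and B: "B \<in> inv_alt_mats m"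
    then have a: "a ^ 2 \<noteq> 0" by simp
    note Bc = inv_alt_matsD(1)[OF B]
    show "f (sheared_sum m a c d B) = (\<omega> (a ^ 2) * \<psi> (- 2 * a * t)) * \<psi> (- 2 * a * (c \<bullet> (T *\<^sub>v d))) *
        (\<omega> (det B) * \<psi> (mat_trace (B * T)))"
      unfolding f_def det_sheared_sum[OF Bc] mat_trace_sheared_sum[OF T Bc cd]
        mult_characterD(2)[OF \<omega> a inv_alt_matsD(2)[OF B]] add_characterD(1)[OF \<psi>(1)]
      by (simp only: mult_ac)
  qed
  also have "\<dots> = (\<Sum>a\<in>{a. a \<noteq> 0}. (\<omega> (a ^ 2) * \<psi> (- 2 * a * t)) *
      (\<Sum>c\<in>?V. \<Sum>d\<in>?V. \<psi> (- 2 * a * (c \<bullet> (T *\<^sub>v d)))) * G)"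
    unfolding G_def alt_gauss_sum_def
    by (simp only: sum_distrib_left[symmetric] sum_distrib_right[symmetric])
  also have "\<dots> = (\<Sum>a\<in>{a. a \<noteq> 0}. (\<omega> (a ^ 2) * \<psi> (- 2 * a * t)) * (of_nat CARD('a) ^ m * G))"
  proof (rule sum.cong[OF refl])
    fix a :: 'a assume "a \<in> {a. a \<noteq> 0}"
    then have "- 2 * a \<noteq> 0" using two by simp
    from sum_add_character_bilinear[OF \<psi> T this]
    show "(\<omega> (a ^ 2) * \<psi> (- 2 * a * t)) * (\<Sum>c\<in>?V. \<Sum>d\<in>?V. \<psi> (- 2 * a * (c \<bullet> (T *\<^sub>v d)))) * G
      = (\<omega> (a ^ 2) * \<psi> (- 2 * a * t)) * (of_nat CARD('a) ^ m * G)"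
      by (simp only: mult.assoc)
  qed
  also have "\<dots> = gauss_sum (\<lambda>a. \<omega> a ^ 2) (\<lambda>a. \<psi> a ^ 2) / \<omega> (t ^ 2) * (of_nat CARD('a) ^ m * G)"
    unfolding sum_distrib_right[symmetric] sum_mult_character_scaled[OF \<omega> \<psi>(1) t] ..
  finally show ?thesis by (simp add: G_def)
qed

text \<open>
  Cyclicity of the trace moves the congruence from $T$ to the summation variable.
\<close>

lemma alt_gauss_sum_congruence:
  fixes P :: "'a::{field,finite} mat"
  assumes P: "P \<in> carrier_mat m m" "det P = 1" and T: "T \<in> inv_alt_mats m"
  shows "alt_gauss_sum m \<omega> \<psi> (P * T * transpose_mat P) = alt_gauss_sum m \<omega> \<psi> T"
proof -
  note Tc = inv_alt_matsD(1)[OF T]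
  let ?Q = "transpose_mat P"
  have Q: "?Q \<in> carrier_mat m m" "det ?Q = 1" "det ?Q \<noteq> 0"
    using P det_transpose[OF P(1)] by simp_all
  have "alt_gauss_sum m \<omega> \<psi> T =
      (\<Sum>A\<in>inv_alt_mats m. \<omega> (det (?Q * A * transpose_mat ?Q)) * \<psi> (mat_trace (?Q * A * transpose_mat ?Q * T)))"
    unfolding alt_gauss_sum_def by (rule sum.reindex_bij_betw[OF bij_betw_congruence[OF Q(1,3)], symmetric])
  also have "\<dots> = (\<Sum>A\<in>inv_alt_mats m. \<omega> (det A) * \<psi> (mat_trace (A * (P * T * ?Q))))"
  proof (rule sum.cong[OF refl])
    fix A :: "'a mat" assume A: "A \<in> inv_alt_mats m"
    note Ac = inv_alt_matsD(1)[OF A]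
    have "?Q * A * transpose_mat ?Q * T = ?Q * (A * P * T)"
      using Ac P(1) Tc by (simp add: assoc_mult_mat[of _ m m _ m _ m])
    then have "mat_trace (?Q * A * transpose_mat ?Q * T) = mat_trace (A * P * T * ?Q)"
      using mat_trace_mult_commute[of ?Q m m "A * P * T"] Ac P(1) Tc by simp
    also have "A * P * T * ?Q = A * (P * T * ?Q)"
      using Ac P(1) Tc by (simp add: assoc_mult_mat[of _ m m _ m _ m])
    finally have tr: "mat_trace (?Q * A * transpose_mat ?Q * T) = mat_trace (A * (P * T * ?Q))" .
    have "det (?Q * A * transpose_mat ?Q) = det A"
      unfolding congruence_inv_alt_mats(2)[OF A Q(1,3)] Q(2) by simp
    with tr show "\<omega> (det (?Q * A * transpose_mat ?Q)) * \<psi> (mat_trace (?Q * A * transpose_mat ?Q * T))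
        = \<omega> (det A) * \<psi> (mat_trace (A * (P * T * ?Q)))"
      by (simp only:)
  qed
  finally show ?thesis by (simp add: alt_gauss_sum_def)
qed

text \<open>
  This moves a nonzero entry of row $0$ into the pivot position.
\<close>

lemma addrow_congruence_first_row:
  fixes A :: "'a::field mat"
  assumes A: "A \<in> inv_alt_mats (Suc (Suc m))" and k: "k < m"
  defines "E \<equiv> addrow_mat (Suc (Suc m)) 1 (Suc 0) (Suc (Suc k))"
  assumes j: "j < Suc (Suc m)"
  shows "(E * A * transpose_mat E) $$ (0, j) =
    A $$ (0, j) + (if j = Suc 0 then A $$ (0, Suc (Suc k)) else 0)"
proof -
  let ?n = "Suc (Suc m)"
  note Ac = inv_alt_matsD(1)[OF A]
  have E: "E \<in> carrier_mat ?n ?n" by (simp add: E_def)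
  have k': "Suc (Suc k) < ?n" using k by simp
  have EA: "E * A = addrow 1 (Suc 0) (Suc (Suc k)) A"
    unfolding E_def by (rule addrow_mat[OF Ac k', symmetric])
  have EAc: "E * A \<in> carrier_mat ?n ?n" using E Ac by simp
  have "E * A * transpose_mat E = transpose_mat (E * transpose_mat (E * A))"
    using transpose_mult[OF E, of "transpose_mat (E * A)" ?n] EAc by simp
  also have "E * transpose_mat (E * A) = addrow 1 (Suc 0) (Suc (Suc k)) (transpose_mat (E * A))"
    unfolding E_def by (rule addrow_mat[symmetric, OF _ k']) (use EAc in \<open>simp add: E_def\<close>)
  finally show ?thesis
    unfolding EA using j k Ac by simp
qed

text \<open>
  Normalisation of $T$: after making the pivot nonzero, the elimination step splits off a hyperbolic
  plane.  All matrices used have determinant $1$, so neither the Gauss sum nor $\det T$ changes.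
\<close>

lemma exists_congruent_hyp_sum:
  fixes T :: "'a::{field,finite} mat"
  assumes two: "(2::'a) \<noteq> 0" and T: "T \<in> inv_alt_mats (Suc (Suc m))"
  shows "\<exists>t T'. t \<noteq> 0 \<and> T' \<in> inv_alt_mats m \<and> det T = t ^ 2 * det T' \<and>
    (\<forall>\<omega> \<psi>. alt_gauss_sum (Suc (Suc m)) \<omega> \<psi> T = alt_gauss_sum (Suc (Suc m)) \<omega> \<psi> (hyp_sum m t T'))"
proof -
  let ?n = "Suc (Suc m)"
  have "\<exists>S\<in>inv_alt_mats ?n. S $$ (0, Suc 0) \<noteq> 0 \<and> det S = det T \<and>
    (\<forall>\<omega> \<psi>. alt_gauss_sum ?n \<omega> \<psi> S = alt_gauss_sum ?n \<omega> \<psi> T)"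
  proof (cases "T $$ (0, Suc 0) = 0")
    case False
    then show ?thesis using T by blast
  next
    case True
    obtain j where j: "j < Suc m" "T $$ (0, Suc j) \<noteq> 0"
      using first_row_nonzero[OF two T] by blast
    with True obtain k where k: "j = Suc k" "k < m" by (cases j) auto
    define E where "E = (addrow_mat ?n 1 (Suc 0) (Suc (Suc k)) :: 'a mat)"
    have E: "E \<in> carrier_mat ?n ?n" "det E = 1" "det E \<noteq> 0"
      using det_addrow_mat[of "Suc 0" "Suc (Suc k)" ?n "1::'a"] by (simp_all add: E_def)
    have "(E * T * transpose_mat E) $$ (0, Suc 0) \<noteq> 0"
      using addrow_congruence_first_row[OF T k(2), of "Suc 0", folded E_def] True j k by simp
    moreover have "det (E * T * transpose_mat E) = det T"
      using congruence_inv_alt_mats(2)[OF T E(1,3)] E(2) by simp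
    ultimately show ?thesis
      using congruence_inv_alt_mats(1)[OF T E(1,3)] alt_gauss_sum_congruence[OF E(1,2) T] by blast
  qed
  then obtain S where S: "S \<in> inv_alt_mats ?n" "S $$ (0, Suc 0) \<noteq> 0" and detS: "det S = det T"
    and GS: "\<And>\<omega> \<psi>. alt_gauss_sum ?n \<omega> \<psi> S = alt_gauss_sum ?n \<omega> \<psi> T"
    by blast
  obtain t c d T' where t: "t \<noteq> 0" and S_eq: "S = sheared_sum m t c d T'" and T': "T' \<in> inv_alt_mats m"
    using inv_alt_mats_eq_sheared_sum[OF two S(1) refl S(2) refl refl refl] S(2) by blast
  have "alt_gauss_sum ?n \<omega> \<psi> S = alt_gauss_sum ?n \<omega> \<psi> (hyp_sum m t T')" for \<omega> \<psi>
    unfolding S_eq sheared_sum_def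
    by (rule alt_gauss_sum_congruence) (use hyp_sum_inv_alt_mats[OF T' t] in simp_all)
  moreover have "det T = t ^ 2 * det T'"
    using detS det_sheared_sum[OF inv_alt_matsD(1)[OF T']] S_eq by simp
  ultimately show ?thesis using t T' GS by metis
qed

lemma inv_alt_mats_0: "inv_alt_mats 0 = {1\<^sub>m 0 :: 'a::field mat}"
  by (auto simp: mem_inv_alt_mats_iff mat_eq_iff)

lemma alt_gauss_sum_0:
  assumes "mult_character \<omega>" "add_character \<psi>" "T \<in> inv_alt_mats 0"
  shows "alt_gauss_sum 0 \<omega> \<psi> T = 1"
  using assms(3) mult_characterD(3)[OF assms(1)] add_characterD(2)[OF assms(2)]
  by (simp add: alt_gauss_sum_def inv_alt_mats_0 mat_trace_def)

lemma alt_gauss_sum_nontrivial: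
  fixes \<omega> \<psi> :: "'a::{field,finite} \<Rightarrow> complex"
  assumes two: "(2::'a) \<noteq> 0" and \<omega>: "mult_character \<omega>"
    and \<psi>: "add_character \<psi>" "\<psi> \<noteq> (\<lambda>_. 1)"
    and T: "T \<in> inv_alt_mats (2 * n)"
  shows "alt_gauss_sum (2 * n) \<omega> \<psi> T =
    of_nat CARD('a) ^ (n * (n - 1)) / \<omega> (det T) * gauss_sum (\<lambda>a. \<omega> a ^ 2) (\<lambda>a. \<psi> a ^ 2) ^ n"
  using T
proof (induction n arbitrary: T)
  case 0
  then show ?case
    using alt_gauss_sum_0[OF \<omega> \<psi>(1), of T] mult_characterD(3)[OF \<omega>] by (simp add: inv_alt_mats_0)
next
  case (Suc n)
  let ?g = "gauss_sum (\<lambda>a. \<omega> a ^ 2) (\<lambda>a. \<psi> a ^ 2)" and ?q = "of_nat CARD('a) :: complex"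
  have T: "T \<in> inv_alt_mats (Suc (Suc (2 * n)))" using Suc.prems by simp
  obtain t T' where t: "t \<noteq> 0" and T': "T' \<in> inv_alt_mats (2 * n)" and det: "det T = t ^ 2 * det T'"
    and G: "alt_gauss_sum (Suc (Suc (2 * n))) \<omega> \<psi> T = alt_gauss_sum (Suc (Suc (2 * n))) \<omega> \<psi> (hyp_sum (2 * n) t T')"
    using exists_congruent_hyp_sum[OF two T] by blast
  have t2: "t ^ 2 \<noteq> 0" using t by simp
  have \<omega>det: "\<omega> (det T) = \<omega> (t ^ 2) * \<omega> (det T')"
    unfolding det by (rule mult_characterD(2)[OF \<omega> t2 inv_alt_matsD(2)[OF T']])
  \<comment> \<open>on natural numbers $n - 1$ truncates at $n = 0$, where the factor $n$ makes up for it\<close>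
  have "2 * n + n * (n - 1) = Suc n * (Suc n - 1)" by (cases n) simp_all
  then have q: "?q ^ (2 * n) * ?q ^ (n * (n - 1)) = ?q ^ (Suc n * (Suc n - 1))"
    by (metis power_add)
  have "alt_gauss_sum (2 * Suc n) \<omega> \<psi> T =
      ?q ^ (2 * n) * (?g / \<omega> (t ^ 2)) * (?q ^ (n * (n - 1)) / \<omega> (det T') * ?g ^ n)"
    using G alt_gauss_sum_hyp_sum[OF two \<omega> \<psi> t T'] Suc.IH[OF T'] by simp
  also have "\<dots> = (?q ^ (2 * n) * ?q ^ (n * (n - 1))) / \<omega> (det T) * ?g ^ Suc n"
    unfolding \<omega>det by simp
  finally show ?case unfolding q .
qed

section \<open>Trivial additive character\<close>

text \<open>
  Row $0$ without its diagonal entry, which is zero.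
\<close>

definition first_row_tail :: "nat \<Rightarrow> 'a mat \<Rightarrow> 'a vec" where
  "first_row_tail m A = vec (Suc m) (\<lambda>j. A $$ (0, Suc j))"

text \<open>
  In block coordinates, prescribing the first row $(0, a, a d)$ means prescribing $a$ and $d$, while
  $c$ and $B$ remain free; moreover $\omega(a^2 \det B) = \omega(\det B)$.
\<close>

lemma sum_first_row_pivot:
  fixes \<omega> :: "'a::{field,finite} \<Rightarrow> complex"
  assumes two: "(2::'a) \<noteq> 0" and \<omega>: "mult_character \<omega>" "\<And>a. a \<noteq> 0 \<Longrightarrow> \<omega> a ^ 2 = 1"
    and w: "w \<in> carrier_vec (Suc m)" "w $ 0 \<noteq> 0"
  shows "(\<Sum>A\<in>{A\<in>inv_alt_mats (Suc (Suc m)). first_row_tail m A = w}. \<omega> (det A)) =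
    of_nat CARD('a) ^ m * (\<Sum>B\<in>inv_alt_mats m. \<omega> (det B))"
proof -
  let ?I = "inv_alt_mats (Suc (Suc m)) :: 'a mat set" and ?V = "carrier_vec m :: 'a vec set"
  define f where "f A = (if first_row_tail m A = w then \<omega> (det A) else 0)" for A
  \<comment> \<open>the multiplier $d$ that the first row $w$ forces\<close>
  define d\<^sub>0 where "d\<^sub>0 = vec m (\<lambda>j. w $ Suc j / w $ 0)"
  define F where "F = (\<Sum>B\<in>inv_alt_mats m. \<omega> (det B))"
  have d0: "d\<^sub>0 \<in> ?V" by (simp add: d\<^sub>0_def)
  have tail: "first_row_tail m (sheared_sum m a c d B) = w \<longleftrightarrow> a = w $ 0 \<and> d = d\<^sub>0"
    if d: "d \<in> ?V" and B: "B \<in> inv_alt_mats m" and a: "a \<noteq> 0" for a c d B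
  proof -
    note ix = index_sheared_sum(1,2)[OF inv_alt_matsD(1)[OF B]]
    let ?r = "first_row_tail m (sheared_sum m a c d B)"
    have r0: "?r $ 0 = a" and rS: "\<And>j. j < m \<Longrightarrow> ?r $ Suc j = a * d $ j"
      by (simp_all add: first_row_tail_def ix)
    show ?thesis
    proof
      assume r: "?r = w"
      then have "a = w $ 0" using r0 by simp
      moreover have "d = d\<^sub>0"
        using d a r0 rS by (intro eq_vecI) (simp_all add: d\<^sub>0_def r)
      ultimately show "a = w $ 0 \<and> d = d\<^sub>0" ..
    next
      assume ad: "a = w $ 0 \<and> d = d\<^sub>0"
      show "?r = w"
      proof (rule eq_vecI)
        fix i assume "i < dim_vec w"
        then have i: "i < Suc m" using w(1) by simp
        show "?r $ i = w $ i"
        proof (cases i)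
          case 0
          then show ?thesis using r0 ad by simp
        next
          case (Suc j)
          then show ?thesis using rS[of j] i ad w(2) by (simp add: d\<^sub>0_def)
        qed
      qed (use w(1) in \<open>simp add: first_row_tail_def\<close>)
    qed
  qed
  have "(\<Sum>A\<in>{A\<in>?I. first_row_tail m A = w}. \<omega> (det A)) =
      (\<Sum>A\<in>{A\<in>?I. A $$ (0, Suc 0) \<noteq> 0}. f A)"
  proof (rule sum.mono_neutral_cong_left)
    show "finite {A\<in>?I. A $$ (0, Suc 0) \<noteq> 0}"
      by (rule finite_subset[OF _ finite_inv_alt_mats]) blast
    show "{A\<in>?I. first_row_tail m A = w} \<subseteq> {A\<in>?I. A $$ (0, Suc 0) \<noteq> 0}"
      using w(2) by (auto simp: first_row_tail_def)
  qed (auto simp: f_def)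
  also have "\<dots> = (\<Sum>a\<in>{a. a \<noteq> 0}. \<Sum>c\<in>?V. \<Sum>d\<in>?V. \<Sum>B\<in>inv_alt_mats m. f (sheared_sum m a c d B))"
    by (rule sum_sheared_sum[OF two])
  also have "\<dots> = (\<Sum>a\<in>{a. a \<noteq> 0}. \<Sum>c\<in>?V. \<Sum>d\<in>?V. if a = w $ 0 then if d = d\<^sub>0 then F else 0 else 0)"
  proof (intro sum.cong refl)
    fix a :: 'a and c d :: "'a vec"
    assume "a \<in> {a. a \<noteq> 0}" and d: "d \<in> ?V"
    then have a: "a \<noteq> 0" "a ^ 2 \<noteq> 0" by simp_all
    have \<omega>2: "\<omega> (a ^ 2) = 1"
      by (simp only: mult_characterD(4)[OF \<omega>(1) a(1)] \<omega>(2)[OF a(1)])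
    have "f (sheared_sum m a c d B) = (if a = w $ 0 then if d = d\<^sub>0 then \<omega> (det B) else 0 else 0)"
      if B: "B \<in> inv_alt_mats m" for B
      unfolding f_def tail[OF d B a(1)] det_sheared_sum[OF inv_alt_matsD(1)[OF B]]
        mult_characterD(2)[OF \<omega>(1) a(2) inv_alt_matsD(2)[OF B]] \<omega>2
      by simp
    then show "(\<Sum>B\<in>inv_alt_mats m. f (sheared_sum m a c d B)) =
        (if a = w $ 0 then if d = d\<^sub>0 then F else 0 else 0)"
      by (simp add: F_def)
  qed
  also have "\<dots> = (\<Sum>a\<in>{a. a \<noteq> 0}. if a = w $ 0 then of_nat CARD('a) ^ m * F else 0)"
    by (intro sum.cong refl) (simp add: d0 finite_carrier_vec card_carrier_vec)
  also have "\<dots> = of_nat CARD('a) ^ m * F"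
    using w(2) by simp
  finally show ?thesis by (simp add: F_def)
qed

text \<open>
  The fibre over any nonzero $w$ is carried by a row and column operation of determinant $1$ onto a
  fibre with nonzero pivot.
\<close>

lemma sum_first_row:
  fixes \<omega> :: "'a::{field,finite} \<Rightarrow> complex"
  assumes two: "(2::'a) \<noteq> 0" and \<omega>: "mult_character \<omega>" "\<And>a. a \<noteq> 0 \<Longrightarrow> \<omega> a ^ 2 = 1"
    and w: "w \<in> carrier_vec (Suc m)" "w \<noteq> 0\<^sub>v (Suc m)"
  shows "(\<Sum>A\<in>{A\<in>inv_alt_mats (Suc (Suc m)). first_row_tail m A = w}. \<omega> (det A)) =
    of_nat CARD('a) ^ m * (\<Sum>B\<in>inv_alt_mats m. \<omega> (det B))"
proof (cases "w $ 0 = 0")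
  case False
  show ?thesis by (rule sum_first_row_pivot[OF two \<omega> w(1) False])
next
  case True
  let ?n = "Suc (Suc m)"
  obtain j where j: "j < Suc m" "w $ j \<noteq> 0"
    using w by (metis carrier_vecD eq_vecI index_zero_vec)
  then obtain k where k: "j = Suc k" "k < m" using True by (cases j) auto
  define E where "E = (addrow_mat ?n 1 (Suc 0) (Suc (Suc k)) :: 'a mat)"
  have E: "E \<in> carrier_mat ?n ?n" "det E = 1" "det E \<noteq> 0"
    using det_addrow_mat[of "Suc 0" "Suc (Suc k)" ?n "1::'a"] by (simp_all add: E_def)
  \<comment> \<open>the operation adds the nonzero entry $w_j$ to the pivot position\<close>
  define e :: "'a vec" where "e = vec (Suc m) (\<lambda>i. if i = 0 then w $ j else 0)"
  let ?g = "\<lambda>A. E * A * transpose_mat E"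
  have tail: "first_row_tail m (?g A) = w + e \<longleftrightarrow> first_row_tail m A = w" if A: "A \<in> inv_alt_mats ?n" for A
  proof -
    have row: "first_row_tail m (?g A) =
        first_row_tail m A + vec (Suc m) (\<lambda>i. if i = 0 then first_row_tail m A $ j else 0)"
      by (rule eq_vecI)
        (use k in \<open>simp_all add: first_row_tail_def addrow_congruence_first_row[OF A k(2), folded E_def]\<close>)
    show ?thesis
    proof
      assume r: "first_row_tail m A = w"
      show "first_row_tail m (?g A) = w + e" unfolding row r e_def ..
    next
      assume eq: "first_row_tail m (?g A) = w + e"
      have ge: "first_row_tail m A $ i + (if i = 0 then first_row_tail m A $ j else 0) =
          w $ i + (if i = 0 then w $ j else 0)" if "i < Suc m" for i
        using arg_cong[OF eq[unfolded row], of "\<lambda>v. v $ i"] that w(1)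
        by (simp add: e_def)
      have pos: "first_row_tail m A $ i = w $ i" if "i < Suc m" "i \<noteq> 0" for i
        using ge[OF that(1)] that(2) by simp
      show "first_row_tail m A = w"
      proof (rule eq_vecI)
        fix i assume "i < dim_vec w"
        then have i: "i < Suc m" using w(1) by simp
        then show "first_row_tail m A $ i = w $ i"
          using ge[OF i] pos[OF i] pos[OF j(1)] k by (cases "i = 0") simp_all
      qed (use w(1) in \<open>simp add: first_row_tail_def\<close>)
    qed
  qed
  have bij: "bij_betw ?g {A\<in>inv_alt_mats ?n. first_row_tail m A = w} {A\<in>inv_alt_mats ?n. first_row_tail m A = w + e}"
    (is "bij_betw _ ?X ?Y")
  proof (rule bij_betw_subset[OF bij_betw_congruence[OF E(1,3)]])
    show "?X \<subseteq> inv_alt_mats ?n" by blast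
    have surj: "?g ` inv_alt_mats ?n = inv_alt_mats ?n"
      by (rule bij_betw_imp_surj_on[OF bij_betw_congruence[OF E(1,3)]])
    show "?g ` ?X = ?Y"
    proof (intro equalityI subsetI)
      fix B assume "B \<in> ?g ` ?X"
      then show "B \<in> ?Y" using tail surj by blast
    next
      fix B assume "B \<in> ?Y"
      then have B: "B \<in> inv_alt_mats ?n" "first_row_tail m B = w + e" by simp_all
      then obtain A where A: "A \<in> inv_alt_mats ?n" "B = ?g A" using surj by blast
      then show "B \<in> ?g ` ?X" using tail B(2) by blast
    qed
  qed
  have "(\<Sum>A\<in>?X. \<omega> (det A)) = (\<Sum>A\<in>?X. \<omega> (det (?g A)))"
    using congruence_inv_alt_mats(2)[OF _ E(1,3)] E(2) by (intro sum.cong refl) simp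
  also have "\<dots> = (\<Sum>A\<in>?Y. \<omega> (det A))"
    by (rule sum.reindex_bij_betw[OF bij])
  also have "\<dots> = of_nat CARD('a) ^ m * (\<Sum>B\<in>inv_alt_mats m. \<omega> (det B))"
    by (rule sum_first_row_pivot[OF two \<omega>]) (use w True j in \<open>simp_all add: e_def\<close>)
  finally show ?thesis .
qed

text \<open>
  The first row of an invertible matrix is one of the $q^{m+1} - 1$ nonzero vectors of length
  $m + 1$, and all of them contribute equally.
\<close>

lemma sum_character_det_recursion:
  fixes \<omega> :: "'a::{field,finite} \<Rightarrow> complex"
  assumes two: "(2::'a) \<noteq> 0" and \<omega>: "mult_character \<omega>" "\<And>a. a \<noteq> 0 \<Longrightarrow> \<omega> a ^ 2 = 1"
  shows "(\<Sum>A\<in>inv_alt_mats (Suc (Suc m)). \<omega> (det A)) =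
    (of_nat CARD('a) ^ Suc m - 1) * of_nat CARD('a) ^ m * (\<Sum>B\<in>inv_alt_mats m. \<omega> (det B))"
proof -
  let ?I = "inv_alt_mats (Suc (Suc m)) :: 'a mat set"
  let ?W = "carrier_vec (Suc m) - {0\<^sub>v (Suc m)} :: 'a vec set"
  have fin: "finite ?W" by (simp add: finite_carrier_vec)
  have "first_row_tail m A \<noteq> 0\<^sub>v (Suc m)" if A: "A \<in> ?I" for A
  proof
    assume z: "first_row_tail m A = 0\<^sub>v (Suc m)"
    obtain j where j: "j < Suc m" "A $$ (0, Suc j) \<noteq> 0"
      using first_row_nonzero[OF two A] by blast
    then have "first_row_tail m A $ j = A $$ (0, Suc j)" by (simp add: first_row_tail_def)
    then show False using z j by simp
  qed
  then have "first_row_tail m ` ?I \<subseteq> ?W"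
    by (auto simp: first_row_tail_def)
  then have "(\<Sum>A\<in>?I. \<omega> (det A)) = (\<Sum>w\<in>?W. \<Sum>A\<in>{A\<in>?I. first_row_tail m A = w}. \<omega> (det A))"
    by (rule sum.group[OF finite_inv_alt_mats fin, symmetric])
  also have "\<dots> = (\<Sum>w\<in>?W. of_nat CARD('a) ^ m * (\<Sum>B\<in>inv_alt_mats m. \<omega> (det B)))"
    by (rule sum.cong[OF refl], rule sum_first_row[OF two \<omega>]) simp_all
  also have "\<dots> = of_nat (card ?W) * (of_nat CARD('a) ^ m * (\<Sum>B\<in>inv_alt_mats m. \<omega> (det B)))"
    by simp
  also have "of_nat (card ?W) = (of_nat CARD('a) ^ Suc m - 1 :: complex)"
  proof -
    have "card ?W = CARD('a) ^ Suc m - 1"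
      by (subst card_Diff_singleton) (simp_all add: card_carrier_vec)
    then show ?thesis by (simp add: of_nat_diff Suc_le_eq)
  qed
  finally show ?thesis by (simp only: mult.assoc)
qed

lemma sum_character_det_quadratic:
  fixes \<omega> :: "'a::{field,finite} \<Rightarrow> complex"
  assumes two: "(2::'a) \<noteq> 0" and \<omega>: "mult_character \<omega>" "\<And>a. a \<noteq> 0 \<Longrightarrow> \<omega> a ^ 2 = 1"
  shows "(\<Sum>A\<in>inv_alt_mats (2 * n). \<omega> (det A)) =
    of_nat CARD('a) ^ (n * (n - 1)) * (\<Prod>i=1..n. (of_nat CARD('a) ^ (2 * i - 1) - 1))"
proof (induction n)
  case 0
  then show ?case using mult_characterD(3)[OF \<omega>(1)] by (simp add: inv_alt_mats_0)
next
  case (Suc n)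
  let ?q = "of_nat CARD('a) :: complex"
  \<comment> \<open>on natural numbers $n - 1$ truncates at $n = 0$, where the factor $n$ makes up for it\<close>
  have "2 * n + n * (n - 1) = Suc n * (Suc n - 1)" by (cases n) simp_all
  then have q: "?q ^ (2 * n) * ?q ^ (n * (n - 1)) = ?q ^ (Suc n * (Suc n - 1))"
    by (metis power_add)
  have "(\<Sum>A\<in>inv_alt_mats (2 * Suc n). \<omega> (det A)) =
      (?q ^ Suc (2 * n) - 1) * ?q ^ (2 * n) *
      (?q ^ (n * (n - 1)) * (\<Prod>i=1..n. (?q ^ (2 * i - 1) - 1)))"
    using sum_character_det_recursion[OF two \<omega>, of "2 * n"] unfolding Suc.IH by simp
  also have "\<dots> = (?q ^ (2 * n) * ?q ^ (n * (n - 1))) *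
      ((\<Prod>i=1..n. (?q ^ (2 * i - 1) - 1)) * (?q ^ (2 * Suc n - 1) - 1))"
    by simp
  also have "(\<Prod>i=1..n. (?q ^ (2 * i - 1) - 1)) * (?q ^ (2 * Suc n - 1) - 1) =
      (\<Prod>i=1..Suc n. (?q ^ (2 * i - 1) - 1))"
    by (rule prod.nat_ivl_Suc'[symmetric, THEN trans[OF mult.commute]]) simp
  finally show ?case unfolding q .
qed

text \<open>
  Scaling the first row and column by $a$ multiplies every summand by $\omega(a)^2 \ne 1$.
\<close>

lemma sum_character_det_eq_0:
  fixes \<omega> :: "'a::{field,finite} \<Rightarrow> complex"
  assumes \<omega>: "mult_character \<omega>" and a: "a \<noteq> 0" "\<omega> a ^ 2 \<noteq> 1" and m: "m > 0"
  shows "(\<Sum>A\<in>inv_alt_mats m. \<omega> (det A)) = 0"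
proof -
  define P where "P = multrow_mat m 0 a"
  have P: "P \<in> carrier_mat m m" "det P = a" "det P \<noteq> 0"
    using det_multrow_mat[OF m, of a] a by (simp_all add: P_def)
  have "(\<Sum>A\<in>inv_alt_mats m. \<omega> (det A)) = (\<Sum>A\<in>inv_alt_mats m. \<omega> (det (P * A * transpose_mat P)))"
    by (rule sum.reindex_bij_betw[OF bij_betw_congruence[OF P(1,3)], symmetric])
  also have "\<dots> = (\<Sum>A\<in>inv_alt_mats m. \<omega> a ^ 2 * \<omega> (det A))"
  proof (rule sum.cong[OF refl])
    fix A :: "'a mat" assume A: "A \<in> inv_alt_mats m"
    have "a ^ 2 \<noteq> 0" using a by simp
    from mult_characterD(2)[OF \<omega> this inv_alt_matsD(2)[OF A]]
    show "\<omega> (det (P * A * transpose_mat P)) = \<omega> a ^ 2 * \<omega> (det A)"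
      unfolding congruence_inv_alt_mats(2)[OF A P(1,3)] P(2) mult_characterD(4)[OF \<omega> a(1)] .
  qed
  also have "\<dots> = \<omega> a ^ 2 * (\<Sum>A\<in>inv_alt_mats m. \<omega> (det A))"
    by (rule sum_distrib_left[symmetric])
  finally show ?thesis using a(2) by simp
qed

theorem theorem3p4p4:
  fixes \<omega> \<psi> :: "'a::{field,finite} \<Rightarrow> complex"
    and T :: "'a mat"
    and n q :: nat
  assumes "q = CARD('a)" and "odd q"
    and "mult_character \<omega>"
    and "add_character \<psi>"
    and "T \<in> inv_alt_mats (2 * n)"
  shows "(\<psi> \<noteq> (\<lambda>_. 1) \<longrightarrow>
            alt_gauss_sum (2 * n) \<omega> \<psi> T =
              of_nat q ^ (n * (n - 1)) / \<omega> (det T) *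
              gauss_sum (\<lambda>a. \<omega> a ^ 2) (\<lambda>a. \<psi> a ^ 2) ^ n) \<and>
         (\<psi> = (\<lambda>_. 1) \<and> (\<forall>a. a \<noteq> 0 \<longrightarrow> \<omega> a ^ 2 = 1) \<longrightarrow>
            alt_gauss_sum (2 * n) \<omega> \<psi> T =
              of_nat q ^ (n * (n - 1)) * (\<Prod>i=1..n. (of_nat q ^ (2 * i - 1) - 1))) \<and>
         (\<psi> = (\<lambda>_. 1) \<and> \<not> (\<forall>a. a \<noteq> 0 \<longrightarrow> \<omega> a ^ 2 = 1) \<and> n > 0 \<longrightarrow>
            alt_gauss_sum (2 * n) \<omega> \<psi> T = 0)"
proof (intro conjI impI)
  have two: "(2::'a) \<noteq> 0"
    using assms(1,2) by (intro two_neq_zero_of_odd_card) simp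
  show "alt_gauss_sum (2 * n) \<omega> \<psi> T =
      of_nat q ^ (n * (n - 1)) / \<omega> (det T) * gauss_sum (\<lambda>a. \<omega> a ^ 2) (\<lambda>a. \<psi> a ^ 2) ^ n"
    if "\<psi> \<noteq> (\<lambda>_. 1)"
    unfolding assms(1) by (rule alt_gauss_sum_nontrivial[OF two assms(3,4) that assms(5)])
  show "alt_gauss_sum (2 * n) \<omega> \<psi> T =
      of_nat q ^ (n * (n - 1)) * (\<Prod>i=1..n. (of_nat q ^ (2 * i - 1) - 1))"
    if "\<psi> = (\<lambda>_. 1) \<and> (\<forall>a. a \<noteq> 0 \<longrightarrow> \<omega> a ^ 2 = 1)"
    using that sum_character_det_quadratic[OF two assms(3), of n]
    by (simp add: alt_gauss_sum_def assms(1))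
  show "alt_gauss_sum (2 * n) \<omega> \<psi> T = 0"
    if "\<psi> = (\<lambda>_. 1) \<and> \<not> (\<forall>a. a \<noteq> 0 \<longrightarrow> \<omega> a ^ 2 = 1) \<and> n > 0"
  proof -
    from that have \<psi>: "\<psi> = (\<lambda>_. 1)" and n: "2 * n > 0" by simp_all
    from that obtain a where a: "a \<noteq> 0" "\<omega> a ^ 2 \<noteq> 1" by blast
    show ?thesis
      unfolding alt_gauss_sum_def \<psi>
      using sum_character_det_eq_0[OF assms(3) a n] by (simp only: mult_1_right)
  qed
qed

end
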